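(* Let $K\ge 2$. For every $\mu\in\mathbb{R}$, $\sigma>0$, $\xi\in\mathbb{R}$, the copula $C_K$ of the $K$-dimensional Multivariate Generalized Extreme Value distribution with parameters $(\mu,\sigma,\xi)$ is given by $$C_K(u_1,\dots,u_K)=\mathcal{H}_K\big(u_1,r_1(u_1,u_2),r_2(u_1,u_2,u_3),\dots,r_{K-1}(u_1,\dots,u_K)\big)$$ for every $(u_1,\dots,u_K)\in[0,1]^K$, where for $2\le m\le K$ $$r_{m-1}(u_1,\dots,u_m)=\psi_m^{-1}(\psi_l(u_l))=\psi_l(u_l)\sum_{j=0}^{m-1}(-1)^j\frac{(\log\psi_l(u_l))^j}{j!}$$ if $l\in\{1,\dots,m\}$ is such that $\psi_l(u_l)=\min(\psi_1(u_1),\dots,\psi_m(u_m))$, and for every $(u_1,\dots,u_K)$ such that $u_1=\psi_1(u_1)\ge\psi_2(u_2)\ge\dots\ge\psi_K(u_K)$, $$\mathcal{H}_K(u_1,\dots,u_K)=\psi_K(u_K)\,J_K\big(-\log u_1,-\log\psi_2(u_2),\dots,-\log\psi_K(u_K)\big)$$ $$=u_K-\psi_K(u_K)\sum_{j=1}^{K-1}\frac{(-\log\psi_j(u_j))^j}{j!}\,J_{K-j}\big(-\log\psi_{j+1}(u_{j+1}),\dots,-\log\psi_K(u_K)\big).$$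
   Context: For parameters $\mu\in\mathbb{R}$, $\sigma>0$, $\xi\in\mathbb{R}$ define $$\Lambda(z)=\Big[1+\xi\,\tfrac{z-\mu}{\sigma}\Big]^{-1/\xi}\ \text{ if }\xi\ne 0 \text{ and } \xi\,\tfrac{z-\mu}{\sigma}>-1,\qquad \Lambda(z)=\exp\big(-\tfrac{z-\mu}{\sigma}\big)\ \text{ if }\xi=0,\ z\in\mathbb{R}.$$ The $K$-dimensional Multivariate Generalized Extreme Value (MGEV) distribution with parameters $(\mu,\sigma,\xi)$ is the probability distribution on $\mathbb{R}^K$ with density $$\tilde g_K(z_1,\dots,z_K)=(-1)^K\exp\{-\Lambda(z_K)\}\prod_{j=1}^K\Lambda'(z_j)\ \text{ if }(z_1,\dots,z_K)\in\Omega_\xi,$$ and $\tilde g_K=0$ otherwise, where $\Omega_0=\{z_1>\dots>z_K\}$, $\Omega_\xi=\{z_1>\dots>z_K>\mu-\frac{\sigma}{\xi}\}$ for $\xi>0$, and $\Omega_\xi=\{\mu-\frac{\sigma}{\xi}>z_1>\dots>z_K\}$ for $\xi<0$. Its $m$-th marginal has distribution function $G_m(z)=\exp\{-\Lambda(z)\}\sum_{j=0}^{m-1}\frac{\Lambda(z)^j}{j!}$ wherever $\Lambda(z)$ is defined (and $0$ below the support, $1$ above it). The marginals being continuous, its copula is unique: the joint distribution function on $[0,1]^K$ of $(G_1(Y_1),\dots,G_K(Y_K))$ when $(Y_1,\dots,Y_K)$ is MGEV distributed. For $m\ge1$, $\psi_m:(0,1)\to(0,1)$ is the increasing function satisfying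 $$u=\psi_m(u)\sum_{j=0}^{m-1}(-1)^j\frac{(\log\psi_m(u))^j}{j!},\qquad u\in(0,1),$$ extended by $\psi_m(0)=0$, $\psi_m(1)=1$; in particular $\psi_1$ is the identity. The polynomials $J_m$ in $m$ variables are defined inductively by $J_1\equiv1$ and $$J_m(x_1,\dots,x_m)=\sum_{j=0}^{m-1}\frac{x_m^j}{j!}-\sum_{j=1}^{m-1}\frac{x_j^j}{j!}\,J_{m-j}(x_{j+1},\dots,x_m),\qquad m\ge2.$$ Convention at the boundary: the formula for $r_{m-1}$ is read as $0$ when $\psi_l(u_l)=0$, and $\mathcal{H}_K(u_1,\dots,u_K)$ is read as $0$ when $\psi_K(u_K)=0$ (the continuous extension). *)

theory Defs
  imports "HOL-Probability.Probability"
begin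

text \<open>
  Vectors \<open>(x\<^sub>1, \<dots>, x\<^sub>K)\<close> are functions \<open>nat \<Rightarrow> real\<close> of which only the values on
  \<open>{1..K}\<close> matter; the distribution lives on the product space \<open>Pi\<^sub>M {1..K} (\<lambda>_. lborel)\<close>.
\<close>

text \<open>Only meaningful where \<open>\<xi> = 0\<close> or \<open>\<xi> * ((z - \<mu>) / \<sigma>) > -1\<close>; it is never used elsewhere.\<close>

definition mgev_Lambda :: "real \<Rightarrow> real \<Rightarrow> real \<Rightarrow> real \<Rightarrow> real" where
  "mgev_Lambda \<mu> \<sigma> \<xi> z =
     (if \<xi> = 0 then exp (- ((z - \<mu>) / \<sigma>))
      else (1 + \<xi> * ((z - \<mu>) / \<sigma>)) powr (- 1 / \<xi>))"

definition mgev_Omega :: "nat \<Rightarrow> real \<Rightarrow> real \<Rightarrow> real \<Rightarrow> (nat \<Rightarrow> real) set" where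
  "mgev_Omega K \<mu> \<sigma> \<xi> =
     {z. (\<forall>i\<in>{1..<K}. z i > z (Suc i)) \<and>
         (\<xi> > 0 \<longrightarrow> z K > \<mu> - \<sigma> / \<xi>) \<and>
         (\<xi> < 0 \<longrightarrow> \<mu> - \<sigma> / \<xi> > z 1)}"

definition mgev_density :: "nat \<Rightarrow> real \<Rightarrow> real \<Rightarrow> real \<Rightarrow> (nat \<Rightarrow> real) \<Rightarrow> real" where
  "mgev_density K \<mu> \<sigma> \<xi> z =
     (if z \<in> mgev_Omega K \<mu> \<sigma> \<xi>
      then (-1) ^ K * exp (- mgev_Lambda \<mu> \<sigma> \<xi> (z K)) *
           (\<Prod>j=1..K. deriv (mgev_Lambda \<mu> \<sigma> \<xi>) (z j))
      else 0)"

definition mgev :: "nat \<Rightarrow> real \<Rightarrow> real \<Rightarrow> real \<Rightarrow> (nat \<Rightarrow> real) measure" where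
  "mgev K \<mu> \<sigma> \<xi> =
     density (Pi\<^sub>M {1..K} (\<lambda>_. lborel)) (\<lambda>z. ennreal (mgev_density K \<mu> \<sigma> \<xi> z))"

definition marginal_cdf :: "('i \<Rightarrow> real) measure \<Rightarrow> 'i \<Rightarrow> real \<Rightarrow> real" where
  "marginal_cdf M i = cdf (distr M borel (\<lambda>y. y i))"

text \<open>
  For a distribution \<open>M\<close> on \<open>\<real>\<^sup>I\<close> with continuous marginals, its (unique) copula: the
  joint distribution function of the vector obtained by applying to each coordinate
  its own marginal distribution function.
\<close>

definition copula :: "'i set \<Rightarrow> ('i \<Rightarrow> real) measure \<Rightarrow> ('i \<Rightarrow> real) \<Rightarrow> real" where
  "copula I M u = measure M {y \<in> space M. \<forall>i\<in>I. marginal_cdf M i (y i) \<le> u i}"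

text \<open>
  For \<open>m \<ge> 1\<close> the map \<open>v \<mapsto> v * (\<Sum>j<m. (-1)^j * (ln v)^j / j!)\<close> has derivative
  \<open>(- ln v)^(m-1) / (m-1)!\<close> on \<open>(0,1)\<close> and is an increasing bijection of \<open>(0,1)\<close>, so the
  description below determines an increasing function.
\<close>

definition psi :: "nat \<Rightarrow> real \<Rightarrow> real" where
  "psi m u =
     (if u \<le> 0 then 0 else if u \<ge> 1 then 1
      else (THE v. 0 < v \<and> v < 1 \<and> u = v * (\<Sum>j=0..m-1. (-1) ^ j * (ln v) ^ j / fact j)))"

lemma psi_1: "0 \<le> u \<Longrightarrow> u \<le> 1 \<Longrightarrow> psi 1 u = u"
  by (auto simp: psi_def)

text \<open>The argument \<open>\<lambda>i. x (j + i)\<close> is the shifted tuple \<open>(x\<^sub>j\<^sub>+\<^sub>1, \<dots>, x\<^sub>m)\<close>.\<close>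

fun mgev_J :: "nat \<Rightarrow> (nat \<Rightarrow> real) \<Rightarrow> real" where
  "mgev_J m x =
     (if m \<le> 1 then 1
      else (\<Sum>j=0..m-1. x m ^ j / fact j) -
           (\<Sum>j=1..m-1. x j ^ j / fact j * mgev_J (m - j) (\<lambda>i. x (j + i))))"

declare mgev_J.simps [simp del]

definition psi_min :: "nat \<Rightarrow> (nat \<Rightarrow> real) \<Rightarrow> real" where
  "psi_min m u = Min ((\<lambda>l. psi l (u l)) ` {1..m})"

definition mgev_r :: "nat \<Rightarrow> (nat \<Rightarrow> real) \<Rightarrow> real" where
  "mgev_r k u = inv_into {0..1} (psi (Suc k)) (psi_min (Suc k) u)"

definition mgev_H_domain :: "nat \<Rightarrow> (nat \<Rightarrow> real) set" where
  "mgev_H_domain K =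
     {u \<in> {1..K} \<rightarrow> {0..1}. \<forall>j\<in>{1..<K}. psi j (u j) \<ge> psi (Suc j) (u (Suc j))}"

text \<open>Only meaningful on \<open>mgev_H_domain K\<close>; the value \<open>0\<close> is the continuous extension.\<close>

definition mgev_H :: "nat \<Rightarrow> (nat \<Rightarrow> real) \<Rightarrow> real" where
  "mgev_H K u =
     (if psi K (u K) = 0 then 0
      else psi K (u K) * mgev_J K (\<lambda>i. - ln (psi i (u i))))"

end

theory Submission
  imports Defs
begin

text \<open>
  The function \<open>\<Lambda>\<close> maps the support of a generalized extreme value distribution decreasingly onto
  the positive reals. If \<open>Z\<close> is MGEV distributed, the substitution \<open>T\<^sub>i = \<Lambda>(Z\<^sub>i)\<close> therefore gives
  \<open>T\<close> the density \<open>exp (- t K)\<close> on \<open>0 < t 1 < \<dots> < t K\<close>, for all parameters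
  (\<open>nn_integral_mgev\<close>): \<open>T\<^sub>1, \<dots>, T\<^sub>K\<close> are the first points of a unit rate Poisson process.
  Everything reduces to one integral: for \<open>0 \<le> b 1 \<le> \<dots> \<le> b K\<close>, the probability that
  \<open>T\<^sub>i \<ge> b i\<close> for all \<open>i\<close> is \<open>exp (- b K)\<close> times \<open>J\<^sub>K(b 1, \<dots>, b K)\<close>
  (\<open>dominating_integral_eq\<close>).

  The formula comes from removing events. \<open>T\<^sub>K \<ge> b K\<close> has probability
  \<open>erlang_tail K (b K)\<close>, that is \<open>exp (- b K)\<close> times the first sum in the recursion of \<open>J\<^sub>K\<close>. From it one
  removes the vectors that violate some bound, sorted by the last index \<open>j < K\<close> with
  \<open>t j < b j\<close>. For such vectors \<open>t j < b j \<le> b (j + 1) \<le> t (j + 1)\<close>, so the coordinates up to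
  \<open>j\<close> and those after \<open>j\<close> no longer constrain each other: the former contribute the volume
  \<open>(b j)^j / j!\<close> of a simplex, the latter the same integral in \<open>K - j\<close> variables. This is the
  \<open>j\<close>-th term of the second sum.

  With bounds \<open>0\<close> before \<open>m\<close> and \<open>a\<close> from \<open>m\<close> on, the formula yields the marginals: the
  \<open>m\<close>-th distribution function is \<open>erlang_tail m\<close> after \<open>\<Lambda>\<close> (\<open>marginal_cdf_mgev\<close>). Since
  \<open>\<psi>\<^sub>m\<close> inverts \<open>v \<mapsto> erlang_tail m (- ln v)\<close>, the copula at \<open>u\<close> is the probability that
  \<open>T\<^sub>i \<ge> - ln (psi i (u i))\<close> for all \<open>i\<close>. As \<open>T\<close> is increasing, these bounds may be
  replaced by their running maxima, that is, each \<open>psi i (u i)\<close> by the running minimum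
  \<open>psi_min i u\<close> (\<open>copula_mgev\<close>). The functions \<open>r\<close> perform this replacement
  on the level of \<open>u\<close>.
\<close>

section \<open>Erlang tails and the functions \<open>\<psi>\<^sub>m\<close>\<close>

text \<open>
  For \<open>t \<ge> 0\<close>, the probability that a Poisson variable of mean \<open>t\<close> is less than \<open>m\<close>,
  equivalently that the \<open>m\<close>-th point of a unit rate Poisson process exceeds \<open>t\<close>.
\<close>

definition erlang_tail :: "nat \<Rightarrow> real \<Rightarrow> real" where
  "erlang_tail m t = exp (- t) * (\<Sum>j<m. t ^ j / fact j)"

text \<open>
  The sum telescopes under differentiation; up to sign only the Erlang density survives.
\<close>

lemma erlang_tail_deriv:
  "(erlang_tail (Suc n) has_real_derivative - (t ^ n / fact n * exp (- t))) (at t)"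
proof (induction n)
  case 0
  show ?case
    unfolding erlang_tail_def by (auto intro!: derivative_eq_intros)
next
  case (Suc n)
  have step: "erlang_tail (Suc (Suc n)) = (\<lambda>t. erlang_tail (Suc n) t + exp (- t) * (t ^ Suc n / fact (Suc n)))"
    by (simp add: fun_eq_iff erlang_tail_def algebra_simps)
  have "((\<lambda>t. exp (- t) * (t ^ Suc n / fact (Suc n))) has_real_derivative
      exp (- t) * (t ^ n / fact n) - exp (- t) * (t ^ Suc n / fact (Suc n))) (at t)"
    by (rule derivative_eq_intros refl | simp)+
  from DERIV_add[OF Suc this] show ?case
    unfolding step by (simp add: algebra_simps)
qed

lemma erlang_tail_0 [simp]: "erlang_tail (Suc n) 0 = 1"
  by (simp add: erlang_tail_def sum.lessThan_Suc_shift del: sum.lessThan_Suc)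

lemma erlang_tail_strict_antimono:
  assumes "m \<ge> 1" "0 \<le> s" "s < t"
  shows "erlang_tail m t < erlang_tail m s"
proof -
  obtain n where m: "m = Suc n"
    using assms(1) by (cases m) auto
  have cont: "continuous_on {s..t} (erlang_tail m)"
    unfolding m by (meson erlang_tail_deriv DERIV_isCont continuous_at_imp_continuous_on)
  show ?thesis
  proof (intro DERIV_neg_imp_decreasing_open[OF assms(3) _ cont] exI conjI)
    fix x assume "s < x"
    then show "(erlang_tail m has_real_derivative - (x ^ n / fact n * exp (- x))) (at x)"
      and "- (x ^ n / fact n * exp (- x)) < 0"
      using assms(2) erlang_tail_deriv[of n x] by (auto simp: m)
  qed
qed

lemma erlang_tail_at_top: "(erlang_tail m \<longlongrightarrow> 0) at_top"
proof -
  have "((\<lambda>t::real. \<Sum>j<m. (t ^ j / exp t) / fact j) \<longlongrightarrow> (\<Sum>j<m. 0 / fact j)) at_top"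
    by (intro tendsto_sum tendsto_divide tendsto_power_div_exp_0 tendsto_const) simp
  then show ?thesis
    by (simp add: erlang_tail_def[abs_def] sum_distrib_left exp_minus divide_inverse mult_ac)
qed

lemma erlang_tail_pos: "m \<ge> 1 \<Longrightarrow> t \<ge> 0 \<Longrightarrow> 0 < erlang_tail m t"
  unfolding erlang_tail_def
  by (intro mult_pos_pos sum_pos2[of _ 0]) auto

lemma erlang_tail_less_iff:
  "m \<ge> 1 \<Longrightarrow> 0 \<le> s \<Longrightarrow> 0 \<le> t \<Longrightarrow> erlang_tail m t < erlang_tail m s \<longleftrightarrow> s < t"
  by (metis erlang_tail_strict_antimono linorder_less_linear order_less_asym)

lemma erlang_tail_surj:
  assumes "m \<ge> 1" "0 < u" "u < 1"
  shows "\<exists>t>0. erlang_tail m t = u"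
proof -
  obtain n where m: "m = Suc n"
    using assms(1) by (cases m) auto
  have "eventually (\<lambda>t. erlang_tail m t < u \<and> t > 0) at_top"
    using order_tendstoD(2)[OF erlang_tail_at_top assms(2)] eventually_gt_at_top
    by (rule eventually_conj)
  then obtain b where b: "erlang_tail m b < u" "b > 0"
    by (auto simp: eventually_at_top_linorder)
  have "\<exists>t. 0 \<le> t \<and> t \<le> b \<and> erlang_tail m t = u"
    using b assms
    by (intro IVT2) (auto simp: m intro: DERIV_isCont[OF erlang_tail_deriv])
  then show ?thesis
    using assms by (auto simp: m le_less)
qed

text \<open>
  The formula that defines \<open>\<psi>\<^sub>m\<close> implicitly, read as a function of \<open>v = \<psi>\<^sub>m(u)\<close> and
  extended continuously by \<open>0\<close>; at \<open>v > 0\<close> and for \<open>m \<ge> 1\<close> it is the Erlang tail at \<open>- ln v\<close>.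
\<close>

definition psi_inv :: "nat \<Rightarrow> real \<Rightarrow> real" where
  "psi_inv m v =
     (if v = 0 then 0 else v * (\<Sum>j=0..m-1. (-1) ^ j * (ln v) ^ j / fact j))"

lemma psi_inv_eq_erlang_tail:
  assumes "m \<ge> 1" "v > 0"
  shows "v * (\<Sum>j=0..m-1. (-1) ^ j * (ln v) ^ j / fact j) = erlang_tail m (- ln v)"
proof -
  have "{0..m-1} = {..<m}"
    using assms by auto
  then show ?thesis
    using assms by (simp add: erlang_tail_def power_minus[of "ln v"])
qed

lemma psi_inv_erlang_tail: "m \<ge> 1 \<Longrightarrow> v > 0 \<Longrightarrow> psi_inv m v = erlang_tail m (- ln v)"
  using psi_inv_eq_erlang_tail[of m v] by (simp only: psi_inv_def) simp

lemma psi_eqI_erlang_tail: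
  assumes "m \<ge> 1" "0 < v" "v < 1" "u = erlang_tail m (- ln v)"
  shows "psi m u = v"
proof -
  obtain n where m: "m = Suc n"
    using assms(1) by (cases m) auto
  have "erlang_tail m (- ln v) < erlang_tail m 0"
    using assms by (intro erlang_tail_strict_antimono) auto
  then have u: "0 < u" "u < 1"
    using erlang_tail_pos[of m "- ln v"] assms by (auto simp: m)
  have "w = v" if "0 < w" "w < 1" "erlang_tail m (- ln w) = u" for w
  proof -
    have "\<not> - ln v < - ln w" "\<not> - ln w < - ln v"
      using that assms erlang_tail_less_iff[of m "- ln v" "- ln w"]
        erlang_tail_less_iff[of m "- ln w" "- ln v"] by auto
    then show ?thesis
      using that assms by (auto simp: not_less intro: antisym)
  qed
  moreover have "u = v * (\<Sum>j=0..m-1. (-1) ^ j * (ln v) ^ j / fact j)"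
    using assms by (simp only: psi_inv_eq_erlang_tail)
  ultimately have "(THE v. 0 < v \<and> v < 1 \<and> u = v * (\<Sum>j=0..m-1. (-1) ^ j * (ln v) ^ j / fact j)) = v"
    using assms(1-3)
    by (intro the_equality) (auto simp only: psi_inv_eq_erlang_tail)
  with u show ?thesis
    by (simp add: psi_def)
qed

lemma psi_at_0 [simp]: "psi m 0 = 0"
  and psi_at_1 [simp]: "psi m 1 = 1"
  by (auto simp: psi_def)

lemma psi_inv_1 [simp]: "m \<ge> 1 \<Longrightarrow> psi_inv m 1 = 1"
  by (cases m) (simp_all add: psi_inv_erlang_tail)

text \<open>
  Strict monotonicity and surjectivity of the Erlang tail make \<open>\<psi>\<^sub>m\<close> and \<open>psi_inv m\<close> mutually
  inverse bijections of the closed unit interval, end points included.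
\<close>

lemma psi_psi_inv:
  assumes "m \<ge> 1" "v \<in> {0..1}"
  shows "psi m (psi_inv m v) = v" "psi_inv m v \<in> {0..1}"
proof -
  have *: "psi m (psi_inv m v) = v \<and> psi_inv m v \<in> {0..1}"
  proof (cases "v = 0 \<or> v = 1")
    case True
    then show ?thesis
      using assms by (auto simp: psi_inv_def[of m 0])
  next
    case False
    with assms have v: "0 < v" "v < 1" by auto
    then have eq: "psi_inv m v = erlang_tail m (- ln v)"
      using assms by (simp add: psi_inv_erlang_tail)
    have "erlang_tail m (- ln v) < erlang_tail m 0"
      using assms v by (intro erlang_tail_strict_antimono) auto
    then show ?thesis
      using psi_eqI_erlang_tail[OF assms(1) v eq] erlang_tail_pos[of m "- ln v"] assms v
      unfolding eq by (cases m) auto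
  qed
  then show "psi m (psi_inv m v) = v" "psi_inv m v \<in> {0..1}" by auto
qed

lemma psi_inv_psi:
  assumes "m \<ge> 1" "u \<in> {0..1}"
  shows "psi_inv m (psi m u) = u" "psi m u \<in> {0..1}"
proof -
  have "psi_inv m (psi m u) = u \<and> psi m u \<in> {0..1}"
  proof (cases "u = 0 \<or> u = 1")
    case True
    then show ?thesis
      using assms by (auto simp: psi_inv_def[of m 0])
  next
    case False
    with assms have "0 < u" "u < 1" by auto
    then obtain t where t: "t > 0" "erlang_tail m t = u"
      using erlang_tail_surj assms(1) by blast
    then have "psi m u = exp (- t)"
      using assms(1) by (intro psi_eqI_erlang_tail) auto
    then show ?thesis
      using t assms by (simp add: psi_inv_erlang_tail)
  qed
  then show "psi_inv m (psi m u) = u" "psi m u \<in> {0..1}" by auto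
qed

lemma inv_into_psi:
  assumes "m \<ge> 1" "v \<in> {0..1}"
  shows "inv_into {0..1} (psi m) v = psi_inv m v"
proof (rule inv_into_f_eq)
  show "inj_on (psi m) {0..1}"
    using psi_inv_psi[OF assms(1)] by (intro inj_on_inverseI[of _ "psi_inv m"])
qed (use psi_psi_inv[OF assms] in auto)

text \<open>
  The \<open>m\<close>-th marginal distribution function is \<open>erlang_tail m\<close> after \<open>\<Lambda>\<close>. This equivalence
  therefore turns the copula condition on one coordinate into a lower bound \<open>- ln (psi m u)\<close>
  on its image under \<open>\<Lambda>\<close>.
\<close>

lemma erlang_tail_le_iff_psi:
  assumes "m \<ge> 1" "u \<in> {0..1}" "psi m u > 0" "t \<ge> 0"
  shows "erlang_tail m t \<le> u \<longleftrightarrow> - ln (psi m u) \<le> t"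
proof -
  have "u = erlang_tail m (- ln (psi m u))"
    using psi_inv_psi(1)[OF assms(1,2)] assms(1,3) by (simp add: psi_inv_erlang_tail)
  moreover have "- ln (psi m u) \<ge> 0"
    using psi_inv_psi(2)[OF assms(1,2)] assms(3) by auto
  ultimately show ?thesis
    using erlang_tail_less_iff[of m t "- ln (psi m u)"] assms by (metis not_less)
qed

lemma psi_min_le: "l \<in> {1..m} \<Longrightarrow> psi_min m u \<le> psi l (u l)"
  by (simp add: psi_min_def)

lemma psi_min_attained: "m \<ge> 1 \<Longrightarrow> \<exists>l\<in>{1..m}. psi_min m u = psi l (u l)"
proof -
  assume "m \<ge> 1"
  then have "psi_min m u \<in> (\<lambda>l. psi l (u l)) ` {1..m}"
    unfolding psi_min_def by (intro Min_in) auto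
  then show ?thesis by blast
qed

lemma psi_min_antimono: "1 \<le> m \<Longrightarrow> m \<le> n \<Longrightarrow> psi_min n u \<le> psi_min m u"
  unfolding psi_min_def by (intro Min_antimono) auto

lemma psi_min_range:
  assumes "u \<in> {1..m} \<rightarrow> {0..1}" "m \<ge> 1"
  shows "psi_min m u \<in> {0..1}"
proof -
  obtain l where l: "l \<in> {1..m}" "psi_min m u = psi l (u l)"
    using psi_min_attained[OF assms(2)] by blast
  moreover have "u l \<in> {0..1}"
    using assms(1) l(1) by (rule funcset_mem)
  ultimately show ?thesis
    using psi_inv_psi(2)[of l "u l"] by simp
qed

section \<open>The polynomials \<open>J\<^sub>m\<close>\<close>

lemma mgev_J_unfold:
  assumes "n \<ge> 1"
  shows "mgev_J n x = (\<Sum>j<n. x n ^ j / fact j) -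
           (\<Sum>j\<in>{0<..<n}. x j ^ j / fact j * mgev_J (n - j) (\<lambda>i. x (j + i)))"
proof (cases "n = 1")
  case True
  have "{0<..<Suc 0} = {}" by auto
  then show ?thesis
    using True by (simp add: mgev_J.simps)
next
  case False
  with assms have "{0..n-1} = {..<n}" "{1..n-1} = {0<..<n}" by auto
  then show ?thesis
    using False assms by (subst mgev_J.simps) simp
qed

lemma mgev_J_cong:
  "(\<And>i. i \<in> {1..n} \<Longrightarrow> x i = y i) \<Longrightarrow> mgev_J n x = mgev_J n y"
proof (induction n arbitrary: x y rule: less_induct)
  case (less n)
  show ?case
  proof (cases "n \<ge> 1")
    case True
    have "mgev_J (n - j) (\<lambda>i. x (j + i)) = mgev_J (n - j) (\<lambda>i. y (j + i))"
      if "j \<in> {0<..<n}" for j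
      using that by (intro less.IH less.prems) auto
    then show ?thesis
      using True less.prems by (simp add: mgev_J_unfold)
  qed (simp add: mgev_J.simps)
qed

text \<open>
  For equal arguments, the shifted polynomials in the recursion are all \<open>1\<close> by induction, and the
  second sum cancels everything in the first sum but its term of index \<open>0\<close>.
\<close>

lemma mgev_J_const: "n \<ge> 1 \<Longrightarrow> mgev_J n (\<lambda>_. a) = 1"
proof (induction n rule: less_induct)
  case (less n)
  have "(\<Sum>j\<in>{0<..<n}. a ^ j / fact j * mgev_J (n - j) (\<lambda>i. a)) = (\<Sum>j\<in>{0<..<n}. a ^ j / fact j)"
    using less.IH by (intro sum.cong) auto
  moreover have "{..<n} = insert 0 {0<..<n}"
    using less.prems by auto
  ultimately show ?case
    using less.prems by (simp add: mgev_J_unfold)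
qed

text \<open>
  If no lower bound is imposed before position \<open>m\<close> and the same bound \<open>a\<close> from there on, only the
  \<open>m\<close>-th coordinate of an increasing vector is really constrained. This value of \<open>J\<close> is what
  makes the \<open>m\<close>-th marginal an Erlang tail.
\<close>

lemma mgev_J_step:
  assumes "1 \<le> m" "m \<le> n"
  shows "mgev_J n (\<lambda>i. if i < m then 0 else a) = (\<Sum>j<m. a ^ j / fact j)"
proof -
  let ?x = "\<lambda>i. if i < m then 0 else a"
  have summand: "?x j ^ j / fact j * mgev_J (n - j) (\<lambda>i. ?x (j + i)) = (if j < m then 0 else a ^ j / fact j)"
    if "j \<in> {0<..<n}" for j
  proof (cases "j < m")
    case False
    then have "(\<lambda>i. ?x (j + i)) = (\<lambda>_. a)" by auto
    then show ?thesis
      using False that mgev_J_const[of "n - j" a] by (simp add: Suc_le_eq)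
  qed (use that in auto)
  have "(\<Sum>j\<in>{0<..<n}. ?x j ^ j / fact j * mgev_J (n - j) (\<lambda>i. ?x (j + i)))
      = (\<Sum>j\<in>{0<..<n}. if j < m then 0 else a ^ j / fact j)"
    by (rule sum.cong[OF refl summand])
  also have "\<dots> = (\<Sum>j\<in>{m..<n}. a ^ j / fact j)"
    using assms by (intro sum.mono_neutral_cong_right) auto
  finally have "mgev_J n ?x = (\<Sum>j<n. a ^ j / fact j) - (\<Sum>j\<in>{m..<n}. a ^ j / fact j)"
    using assms by (simp add: mgev_J_unfold)
  moreover have "{..<n} = {..<m} \<union> {m..<n}"
    using assms by auto
  ultimately show ?thesis
    by (simp add: sum.union_disjoint ivl_disj_int)
qed

section \<open>Integrals over increasing vectors\<close>

text \<open>
  A measure on all of \<open>\<real>\<close> rather than a restriction of the space, so that it is a factor of product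
  measures over the same Borel sets as \<open>lborel\<close>.
\<close>

definition half_line :: "real measure" where
  "half_line = density lborel (indicator {0<..})"

lemma sets_half_line [simp, measurable_cong]: "sets half_line = sets borel"
  and space_half_line [simp]: "space half_line = UNIV"
  by (simp_all add: half_line_def)

lemma nn_integral_half_line:
  "f \<in> borel_measurable borel \<Longrightarrow>
    (\<integral>\<^sup>+ t. f t \<partial>half_line) = (\<integral>\<^sup>+ t. f t * indicator {0<..} t \<partial>lborel)"
  by (simp add: half_line_def nn_integral_density mult.commute)

lemma nn_integral_half_line_atLeast:
  assumes "f \<in> borel_measurable borel" "b \<ge> 0"
  shows "(\<integral>\<^sup>+ t. (if b \<le> t then f t else 0) \<partial>half_line) = (\<integral>\<^sup>+ t. f t * indicator {b..} t \<partial>lborel)"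
proof -
  have "(\<integral>\<^sup>+ t. (if b \<le> t then f t else 0) \<partial>half_line)
      = (\<integral>\<^sup>+ t. (if b \<le> t then f t else 0) * indicator {0<..} t \<partial>lborel)"
    by (rule nn_integral_half_line) (use assms(1) in measurable)
  also have "\<dots> = (\<integral>\<^sup>+ t. f t * indicator {b..} t \<partial>lborel)"
    using AE_lborel_singleton[of "0::real"] assms(2)
    by (intro nn_integral_cong_AE) (auto simp: indicator_def)
  finally show ?thesis .
qed

lemma nn_integral_half_line_power:
  assumes "y \<ge> 0"
  shows "(\<integral>\<^sup>+ t. (if t < y then ennreal (t ^ k / fact k) else 0) \<partial>half_line)
    = ennreal (y ^ Suc k / fact (Suc k))"
proof -
  have "(\<integral>\<^sup>+ t. (if t < y then ennreal (t ^ k / fact k) else 0) \<partial>half_line)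
      = (\<integral>\<^sup>+ t. (if t < y then ennreal (t ^ k / fact k) else 0) * indicator {0<..} t \<partial>lborel)"
    by (intro nn_integral_half_line) measurable
  also have "\<dots> = (\<integral>\<^sup>+ t. ennreal (t ^ k / fact k) * indicator {0..y} t \<partial>lborel)"
    using AE_lborel_singleton[of "0::real"] AE_lborel_singleton[of y]
    by (intro nn_integral_cong_AE) (auto simp: indicator_def)
  also have "\<dots> = ennreal (y ^ Suc k / fact (Suc k) - 0 ^ Suc k / fact (Suc k))"
  proof (rule nn_integral_FTC_Icc[where F = "\<lambda>t. t ^ Suc k / fact (Suc k)", OF _ _ _ assms])
    fix x :: real assume "x \<in> {0..y}"
    then show "0 \<le> x ^ k / fact k" by simp
  next
    fix x :: real
    show "((\<lambda>x. x ^ Suc k / fact (Suc k)) has_real_derivative x ^ k / fact k) (at x)"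
      by (rule derivative_eq_intros refl | simp)+
  qed measurable
  finally show ?thesis by simp
qed

lemma nn_integral_half_line_erlang:
  assumes "b \<ge> 0"
  shows "(\<integral>\<^sup>+ t. (if b \<le> t then ennreal (exp (- t)) else 0) * ennreal (t ^ k / fact k) \<partial>half_line)
    = ennreal (erlang_tail (Suc k) b)"
proof -
  have "(\<integral>\<^sup>+ t. (if b \<le> t then ennreal (exp (- t)) else 0) * ennreal (t ^ k / fact k) \<partial>half_line)
      = (\<integral>\<^sup>+ t. (if b \<le> t then ennreal (t ^ k / fact k * exp (- t)) else 0) \<partial>half_line)"
    using assms by (intro nn_integral_cong) (auto simp flip: ennreal_mult simp: mult.commute)
  also have "\<dots> = (\<integral>\<^sup>+ t. ennreal (t ^ k / fact k * exp (- t)) * indicator {b..} t \<partial>lborel)"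
    using assms by (intro nn_integral_half_line_atLeast) auto
  also have "\<dots> = ennreal (- 0 - - erlang_tail (Suc k) b)"
  proof (rule nn_integral_FTC_atLeast)
    show "((\<lambda>t. - erlang_tail (Suc k) t) \<longlongrightarrow> - 0) at_top"
      by (intro tendsto_minus erlang_tail_at_top)
    fix x assume "b \<le> x"
    then show "0 \<le> x ^ k / fact k * exp (- x)"
      using assms by simp
    show "((\<lambda>t. - erlang_tail (Suc k) t) has_real_derivative x ^ k / fact k * exp (- x)) (at x)"
      using DERIV_minus[OF erlang_tail_deriv[of k x]] by simp
  qed measurable
  finally show ?thesis by simp
qed

lemma sigma_finite_half_line: "sigma_finite_measure half_line"
  unfolding half_line_def
  by (subst sigma_finite_measure.sigma_finite_iff_density_finite[OF lborel.sigma_finite_measure_axioms])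
    (auto simp: indicator_def)

interpretation hl: product_sigma_finite "\<lambda>_::nat. half_line"
  by standard (rule sigma_finite_measure.sigma_finite_countable[OF sigma_finite_half_line])

abbreviation half_space :: "nat \<Rightarrow> nat \<Rightarrow> (nat \<Rightarrow> real) measure" where
  "half_space m n \<equiv> Pi\<^sub>M {m<..n} (\<lambda>_. half_line)"

text \<open>
  The coordinates are those with index in \<open>{m<..n}\<close>, so that a vector splits at any index \<open>j\<close>
  into blocks \<open>{m<..j}\<close> and \<open>{j<..n}\<close> without renumbering.
\<close>

definition increasing :: "nat \<Rightarrow> nat \<Rightarrow> (nat \<Rightarrow> real) \<Rightarrow> bool" where
  "increasing m n t \<longleftrightarrow> (\<forall>i\<in>{m<..<n}. t i < t (Suc i))"

lemma increasing_less:
  assumes "increasing m n t" "m < i" "i < j" "j \<le> n"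
  shows "t i < t j"
proof -
  from \<open>i < j\<close> have "Suc i \<le> j" by simp
  then show ?thesis
    using assms(4)
  proof (induction j rule: dec_induct)
    case base
    then show ?case using assms(1,2) by (auto simp: increasing_def)
  next
    case (step j)
    then have "t j < t (Suc j)"
      using assms(1,2) by (auto simp: increasing_def)
    with step show ?case by simp
  qed
qed

lemma pred_increasing [measurable]:
  "{m<..n} \<subseteq> I \<Longrightarrow> Measurable.pred (Pi\<^sub>M I (\<lambda>_. half_line)) (increasing m n)"
  unfolding increasing_def
  by (intro pred_intros_finite borel_measurable_pred_less
      measurable_component_singleton[THEN measurable_compose] finite_greaterThanLessThan) auto

lemma pred_lower_bounds [measurable]:
  "J \<subseteq> I \<Longrightarrow> finite J \<Longrightarrow> Measurable.pred (Pi\<^sub>M I (\<lambda>_. half_line)) (\<lambda>t. \<forall>i\<in>J. b i \<le> t i)"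
  by (intro pred_intros_finite) (auto simp: Measurable.pred_def
      intro!: borel_measurable_le measurable_component_singleton[THEN measurable_compose])

lemma AE_half_line_pos: "AE t in half_line. 0 < t"
  unfolding half_line_def by (subst AE_density) (auto simp: indicator_def)

text \<open>
  Under Lebesgue measure on increasing vectors of \<open>k\<close> positive reals, the last coordinate \<open>s\<close>
  has density \<open>s^(k-1) / (k-1)!\<close>, the volume of the simplex of the other coordinates below \<open>s\<close>.
  In the induction the new last coordinate \<open>y\<close> is fixed first; it enters the inner integral only as
  an upper bound on the previous last coordinate.
\<close>

lemma nn_integral_increasing_last:
  assumes "m < n" and "f \<in> borel_measurable borel"
  shows "(\<integral>\<^sup>+ t. (if increasing m n t then f (t n) else 0) \<partial>half_space m n)
    = (\<integral>\<^sup>+ s. f s * ennreal (s ^ (n - Suc m) / fact (n - Suc m)) \<partial>half_line)"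
proof -
  from assms(1) have "Suc m \<le> n" by simp
  then show ?thesis
    using assms(2)
  proof (induction n arbitrary: f rule: dec_induct)
    case base
    have "{m<..Suc m} = {Suc m}" "{m<..<Suc m} = {}" by auto
    with base show ?case
      using hl.product_nn_integral_singleton[of f "Suc m"] by (simp add: increasing_def)
  next
    case (step n)
    note [measurable] = step.prems
    have ins: "{m<..Suc n} = insert (Suc n) {m<..n}"
      using step.hyps by auto
    have split: "increasing m (Suc n) (x(Suc n := y)) \<longleftrightarrow> increasing m n x \<and> x n < y" for x y
    proof -
      have "{m<..<Suc n} = insert n {m<..<n}"
        using step.hyps by auto
      then show ?thesis
        by (auto simp: increasing_def)
    qed
    have inner: "(\<integral>\<^sup>+ x. (if increasing m (Suc n) (x(Suc n := y)) then f y else 0) \<partial>half_space m n)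
        = f y * ennreal (y ^ (n - m) / fact (n - m))" if "0 < y" for y
    proof -
      have "(\<integral>\<^sup>+ x. (if increasing m (Suc n) (x(Suc n := y)) then f y else 0) \<partial>half_space m n)
          = (\<integral>\<^sup>+ x. (if increasing m n x then (if x n < y then f y else 0) else 0) \<partial>half_space m n)"
        by (intro nn_integral_cong) (simp add: split)
      also have "\<dots> = (\<integral>\<^sup>+ s. (if s < y then f y else 0) *
          ennreal (s ^ (n - Suc m) / fact (n - Suc m)) \<partial>half_line)"
        by (rule step.IH) measurable
      also have "\<dots> = (\<integral>\<^sup>+ s. f y *
          (if s < y then ennreal (s ^ (n - Suc m) / fact (n - Suc m)) else 0) \<partial>half_line)"
        by (intro nn_integral_cong) simp
      also have "\<dots> = f y * (\<integral>\<^sup>+ s.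
          (if s < y then ennreal (s ^ (n - Suc m) / fact (n - Suc m)) else 0) \<partial>half_line)"
        by (rule nn_integral_cmult) measurable
      also have "(\<integral>\<^sup>+ s. (if s < y then ennreal (s ^ (n - Suc m) / fact (n - Suc m)) else 0) \<partial>half_line)
          = ennreal (y ^ Suc (n - Suc m) / fact (Suc (n - Suc m)))"
        using that by (intro nn_integral_half_line_power) simp
      also have "Suc (n - Suc m) = n - m"
        using step.hyps by simp
      finally show ?thesis .
    qed
    have "(\<integral>\<^sup>+ t. (if increasing m (Suc n) t then f (t (Suc n)) else 0) \<partial>half_space m (Suc n))
        = (\<integral>\<^sup>+ y. \<integral>\<^sup>+ x. (if increasing m (Suc n) (x(Suc n := y)) then f ((x(Suc n := y)) (Suc n)) else 0)
            \<partial>half_space m n \<partial>half_line)"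
      unfolding ins
      by (rule hl.product_nn_integral_insert_rev) (simp_all, measurable, auto)
    also have "\<dots> = (\<integral>\<^sup>+ y. f y * ennreal (y ^ (n - m) / fact (n - m)) \<partial>half_line)"
      unfolding fun_upd_same
      using AE_half_line_pos by (intro nn_integral_cong_AE) (auto elim!: eventually_mono simp: inner)
    finally show ?case by simp
  qed
qed

definition dominating_integral :: "nat \<Rightarrow> nat \<Rightarrow> (nat \<Rightarrow> real) \<Rightarrow> ennreal" where
  "dominating_integral m n b =
     (\<integral>\<^sup>+ t. (if increasing m n t \<and> (\<forall>i\<in>{m<..n}. b i \<le> t i) then ennreal (exp (- t n)) else 0)
       \<partial>half_space m n)"

lemma measurable_dominating_integrand:
  assumes "m < n" "{m<..n} \<subseteq> I"
  shows "(\<lambda>t. if increasing m n t \<and> (\<forall>i\<in>{m<..n}. b i \<le> t i) then ennreal (exp (- t n)) else 0)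
    \<in> borel_measurable (Pi\<^sub>M I (\<lambda>_. half_line))"
proof -
  note [measurable] = pred_increasing[OF assms(2)] pred_lower_bounds[OF assms(2)]
  have [measurable]: "(\<lambda>t. t n) \<in> borel_measurable (Pi\<^sub>M I (\<lambda>_. half_line))"
    using assms measurable_component_singleton[of n I "\<lambda>_. half_line"] by auto
  show ?thesis by measurable
qed

lemma measurable_below_integrand:
  assumes "m < n" "{m<..n} \<subseteq> I"
  shows "(\<lambda>t. if increasing m n t \<and> t n < c then 1 else 0 :: ennreal)
    \<in> borel_measurable (Pi\<^sub>M I (\<lambda>_. half_line))"
proof -
  note [measurable] = pred_increasing[OF assms(2)]
  have [measurable]: "(\<lambda>t. t n) \<in> borel_measurable (Pi\<^sub>M I (\<lambda>_. half_line))"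
    using assms measurable_component_singleton[of n I "\<lambda>_. half_line"] by auto
  show ?thesis by measurable
qed

lemma nn_integral_increasing_below:
  assumes "m < n" "c \<ge> 0"
  shows "(\<integral>\<^sup>+ t. (if increasing m n t \<and> t n < c then 1 else 0) \<partial>half_space m n)
    = ennreal (c ^ (n - m) / fact (n - m))"
proof -
  have "(\<integral>\<^sup>+ t. (if increasing m n t \<and> t n < c then 1 else 0) \<partial>half_space m n)
      = (\<integral>\<^sup>+ t. (if increasing m n t then (if t n < c then 1 else 0) else 0) \<partial>half_space m n)"
    by (intro nn_integral_cong) auto
  also have "\<dots> = (\<integral>\<^sup>+ s. (if s < c then 1 else 0) * ennreal (s ^ (n - Suc m) / fact (n - Suc m)) \<partial>half_line)"
    by (rule nn_integral_increasing_last[OF assms(1)]) measurable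
  also have "\<dots> = (\<integral>\<^sup>+ s. (if s < c then ennreal (s ^ (n - Suc m) / fact (n - Suc m)) else 0) \<partial>half_line)"
    by (intro nn_integral_cong) auto
  also have "\<dots> = ennreal (c ^ Suc (n - Suc m) / fact (Suc (n - Suc m)))"
    by (rule nn_integral_half_line_power[OF assms(2)])
  also have "Suc (n - Suc m) = n - m"
    using assms by simp
  finally show ?thesis .
qed

text \<open>
  Sort the increasing vectors with \<open>b n \<le> t n\<close> by the largest index \<open>j\<close> at which the lower bound
  fails, if there is one. Given \<open>t j < b j\<close> and the bounds after \<open>j\<close>, the order between the
  coordinates \<open>j\<close> and \<open>j + 1\<close> is automatic because \<open>b\<close> is monotone, so the two blocks
  put no condition on one another: this is what turns the integral into a product.
\<close>

lemma last_violation_decomposition: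
  fixes b t :: "nat \<Rightarrow> real"
  assumes "m < n" and b: "mono_on {m<..n} b"
  shows "(if increasing m n t then if b n \<le> t n then ennreal (exp (- t n)) else 0 else 0) =
    (if increasing m n t \<and> (\<forall>i\<in>{m<..n}. b i \<le> t i) then ennreal (exp (- t n)) else 0) +
    (\<Sum>j\<in>{m<..<n}. (if increasing m j t \<and> t j < b j then 1 else 0) *
      (if increasing j n t \<and> (\<forall>i\<in>{j<..n}. b i \<le> t i) then ennreal (exp (- t n)) else 0))"
  (is "?L = ?A + (\<Sum>j\<in>_. ?B j)")
proof -
  define last where
    "last j \<longleftrightarrow> increasing m n t \<and> t j < b j \<and> (\<forall>i\<in>{j<..n}. b i \<le> t i)" for j
  have B: "?B j = (if last j then ennreal (exp (- t n)) else 0)" if j: "j \<in> {m<..<n}" for j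
  proof -
    have "increasing m n t \<longleftrightarrow> increasing m j t \<and> t j < t (Suc j) \<and> increasing j n t"
    proof -
      have "{m<..<n} = {m<..<j} \<union> {j} \<union> {j<..<n}"
        using j by auto
      then show ?thesis
        unfolding increasing_def by blast
    qed
    moreover have "b j \<le> b (Suc j)"
      using j by (intro mono_onD[OF b]) auto
    moreover have "Suc j \<in> {j<..n}"
      using j by auto
    ultimately show ?thesis
      unfolding last_def by (smt (verit) mult_1 mult_zero_left mult_zero_right)
  qed
  have sum: "(\<Sum>j\<in>{m<..<n}. ?B j) = (\<Sum>j\<in>{m<..<n}. if last j then ennreal (exp (- t n)) else 0)"
    by (intro sum.cong refl B)
  consider (no) "\<not> (increasing m n t \<and> b n \<le> t n)"
    | (all) "increasing m n t" "\<forall>i\<in>{m<..n}. b i \<le> t i"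
    | (some) "increasing m n t" "b n \<le> t n" "\<exists>i\<in>{m<..n}. t i < b i"
    using \<open>m < n\<close> by force
  then show ?thesis
  proof cases
    case no
    then have "\<not> last j" if "j \<in> {m<..<n}" for j
      using that by (auto simp: last_def)
    then show ?thesis
      unfolding sum using no \<open>m < n\<close> by auto
  next
    case all
    then have "\<not> last j" if "j \<in> {m<..<n}" for j
      using that by (force simp: last_def)
    then show ?thesis
      unfolding sum using all \<open>m < n\<close> by auto
  next
    case some
    let ?I = "{i\<in>{m<..n}. t i < b i}"
    define j0 where "j0 = Max ?I"
    have "?I \<noteq> {}" using some by auto
    then have "j0 \<in> ?I" unfolding j0_def by (intro Max_in) auto
    moreover have max: "i \<le> j0" if "i \<in> ?I" for i
      unfolding j0_def using that by (intro Max_ge) auto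
    ultimately have j0: "j0 \<in> {m<..<n}" "t j0 < b j0"
      using some(2) by (auto simp: le_less)
    have "b i \<le> t i" if "i \<in> {j0<..n}" for i
      using max[of i] that j0(1) by force
    then have "last j0"
      using some(1) j0 by (simp add: last_def)
    moreover have "j = j0" if "j \<in> {m<..<n}" "last j" for j
    proof (rule antisym)
      show "j \<le> j0"
        using that by (intro max) (auto simp: last_def)
      show "j0 \<le> j"
      proof (rule ccontr)
        assume "\<not> j0 \<le> j"
        then have "b j0 \<le> t j0"
          using that(2) j0(1) by (simp add: last_def)
        then show False using j0(2) by simp
      qed
    qed
    ultimately have last: "last j \<longleftrightarrow> j = j0" if "j \<in> {m<..<n}" for j
      using that by blast
    have "(\<Sum>j\<in>{m<..<n}. if last j then ennreal (exp (- t n)) else 0)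
        = (\<Sum>j\<in>{m<..<n}. if j = j0 then ennreal (exp (- t n)) else 0)"
      by (intro sum.cong refl) (simp add: last)
    also have "\<dots> = ennreal (exp (- t n))"
      using j0(1) by simp
    finally show ?thesis
      unfolding sum using some by (auto simp: not_le)
  qed
qed

lemma nn_integral_last_violation:
  assumes "m < j" "j < n" "c \<ge> 0"
  shows "(\<integral>\<^sup>+ t. (if increasing m j t \<and> t j < c then 1 else 0) *
      (if increasing j n t \<and> (\<forall>i\<in>{j<..n}. b i \<le> t i) then ennreal (exp (- t n)) else 0) \<partial>half_space m n)
    = ennreal (c ^ (j - m) / fact (j - m)) * dominating_integral j n b"
    (is "(\<integral>\<^sup>+ t. ?F t * ?G t \<partial>_) = _")
proof -
  have un: "{m<..n} = {m<..j} \<union> {j<..n}"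
    using assms by auto
  have n: "n \<in> {j<..n}" and j: "j \<in> {m<..j}" using assms by auto
  have [measurable]: "?G \<in> borel_measurable (half_space j n)"
    using assms by (intro measurable_dominating_integrand) auto
  have [measurable]: "?F \<in> borel_measurable (half_space m j)"
    using assms by (intro measurable_below_integrand) auto
  have "(\<integral>\<^sup>+ t. ?F t * ?G t \<partial>half_space m n)
      = (\<integral>\<^sup>+ x. \<integral>\<^sup>+ y. ?F (merge {m<..j} {j<..n} (x, y)) * ?G (merge {m<..j} {j<..n} (x, y))
          \<partial>half_space j n \<partial>half_space m j)"
    unfolding un
  proof (rule hl.product_nn_integral_fold)
    show "(\<lambda>t. ?F t * ?G t) \<in> borel_measurable (Pi\<^sub>M ({m<..j} \<union> {j<..n}) (\<lambda>_. half_line))"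
      using assms
      by (intro borel_measurable_times_ennreal measurable_dominating_integrand measurable_below_integrand) auto
  qed auto
  also have "\<dots> = (\<integral>\<^sup>+ x. \<integral>\<^sup>+ y. ?F x * ?G y \<partial>half_space j n \<partial>half_space m j)"
  proof (intro nn_integral_cong arg_cong2[where f = "(*)"])
    fix x y :: "nat \<Rightarrow> real"
    let ?z = "merge {m<..j} {j<..n} (x, y)"
    have low: "?z i = x i" if "i \<in> {m<..j}" for i
      using that by (simp add: merge_def)
    have high: "?z i = y i" if "i \<in> {j<..n}" for i
      using that by (simp add: merge_def)
    show "?F ?z = ?F x"
    proof -
      have "increasing m j ?z = increasing m j x"
        unfolding increasing_def using low by (intro ball_cong refl) auto
      then show ?thesis using low[OF j] by simp
    qed
    show "?G ?z = ?G y"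
    proof -
      have "increasing j n ?z = increasing j n y"
        unfolding increasing_def using high by (intro ball_cong refl) auto
      then show ?thesis using high[OF n] high by simp
    qed
  qed
  also have "\<dots> = (\<integral>\<^sup>+ x. ?F x * dominating_integral j n b \<partial>half_space m j)"
    by (simp add: dominating_integral_def nn_integral_cmult)
  also have "\<dots> = (\<integral>\<^sup>+ x. ?F x \<partial>half_space m j) * dominating_integral j n b"
    by (rule nn_integral_multc) measurable
  also have "(\<integral>\<^sup>+ x. ?F x \<partial>half_space m j) = ennreal (c ^ (j - m) / fact (j - m))"
    by (rule nn_integral_increasing_below[OF assms(1,3)])
  finally show ?thesis .
qed

text \<open>
  Integrating the decomposition by the last violated bound gives exactly the recursion of \<open>J\<close>: the
  left-hand side integrates to an Erlang tail, which is the first sum, and the class of index \<open>j\<close>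
  contributes the volume of a simplex times the same integral for the later block. Nonnegativity of
  \<open>J\<close> is proved along with it, since subtraction is only meaningful after it is known that the
  summed classes do not exceed the whole.
\<close>

lemma dominating_integral_eq:
  assumes "m < n" "mono_on {m<..n} b" "\<And>i. i \<in> {m<..n} \<Longrightarrow> 0 \<le> b i"
  shows "mgev_J (n - m) (\<lambda>i. b (m + i)) \<ge> 0"
    and "dominating_integral m n b = ennreal (exp (- b n) * mgev_J (n - m) (\<lambda>i. b (m + i)))"
proof -
  have "mgev_J (n - m) (\<lambda>i. b (m + i)) \<ge> 0 \<and>
    dominating_integral m n b = ennreal (exp (- b n) * mgev_J (n - m) (\<lambda>i. b (m + i)))"
    using assms
  proof (induction "n - m" arbitrary: m rule: less_induct)
    case less
    let ?s = "\<lambda>j. b j ^ (j - m) / fact (j - m) * (exp (- b n) * mgev_J (n - j) (\<lambda>i. b (j + i)))"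
    have n: "n \<in> {m<..n}" using less.prems by auto
    have IH: "mgev_J (n - j) (\<lambda>i. b (j + i)) \<ge> 0 \<and>
        dominating_integral j n b = ennreal (exp (- b n) * mgev_J (n - j) (\<lambda>i. b (j + i)))"
      if "j \<in> {m<..<n}" for j
      using that less.prems by (intro less.hyps) (auto intro: monotone_on_subset)
    have b: "0 \<le> b j" if "j \<in> {m<..n}" for j
      using less.prems(3) that by simp
    have s_nonneg: "?s j \<ge> 0" if "j \<in> {m<..<n}" for j
      using that IH[of j] b[of j] by simp
    have total: "ennreal (erlang_tail (n - m) (b n)) = dominating_integral m n b + ennreal (\<Sum>j\<in>{m<..<n}. ?s j)"
    proof -
      have "ennreal (erlang_tail (n - m) (b n)) = (\<integral>\<^sup>+ s. (if b n \<le> s then ennreal (exp (- s)) else 0)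
          * ennreal (s ^ (n - Suc m) / fact (n - Suc m)) \<partial>half_line)"
        using nn_integral_half_line_erlang[OF b[OF n], of "n - Suc m"] less.prems(1)
        by (simp add: Suc_diff_Suc)
      also have "\<dots> = (\<integral>\<^sup>+ t. (if increasing m n t then if b n \<le> t n then ennreal (exp (- t n)) else 0 else 0)
          \<partial>half_space m n)"
        by (rule nn_integral_increasing_last[OF less.prems(1), symmetric]) measurable
      also have "\<dots> = dominating_integral m n b + (\<Sum>j\<in>{m<..<n}. \<integral>\<^sup>+ t. (if increasing m j t \<and> t j < b j then 1 else 0) *
          (if increasing j n t \<and> (\<forall>i\<in>{j<..n}. b i \<le> t i) then ennreal (exp (- t n)) else 0) \<partial>half_space m n)"
        unfolding last_violation_decomposition[OF less.prems(1,2)] dominating_integral_def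
        using less.prems(1)
        by (subst nn_integral_add; (subst nn_integral_sum)?)
          (auto intro!: borel_measurable_sum borel_measurable_times_ennreal
            measurable_dominating_integrand measurable_below_integrand)
      also have "(\<Sum>j\<in>{m<..<n}. \<integral>\<^sup>+ t. (if increasing m j t \<and> t j < b j then 1 else 0) *
          (if increasing j n t \<and> (\<forall>i\<in>{j<..n}. b i \<le> t i) then ennreal (exp (- t n)) else 0) \<partial>half_space m n)
          = (\<Sum>j\<in>{m<..<n}. ennreal (?s j))"
      proof (intro sum.cong refl)
        fix j assume j: "j \<in> {m<..<n}"
        then show "(\<integral>\<^sup>+ t. (if increasing m j t \<and> t j < b j then 1 else 0) *
          (if increasing j n t \<and> (\<forall>i\<in>{j<..n}. b i \<le> t i) then ennreal (exp (- t n)) else 0) \<partial>half_space m n)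
          = ennreal (?s j)"
          using IH[OF j] b[of j] by (subst nn_integral_last_violation) (auto simp flip: ennreal_mult)
      qed
      also have "\<dots> = ennreal (\<Sum>j\<in>{m<..<n}. ?s j)"
        by (intro sum_ennreal s_nonneg)
      finally show ?thesis .
    qed
    have J: "exp (- b n) * mgev_J (n - m) (\<lambda>i. b (m + i)) = erlang_tail (n - m) (b n) - (\<Sum>j\<in>{m<..<n}. ?s j)"
    proof -
      have "(\<Sum>j\<in>{m<..<n}. ?s j) = (\<Sum>j\<in>{0<..<n - m}.
          exp (- b n) * (b (m + j) ^ j / fact j * mgev_J (n - m - j) (\<lambda>i. b (m + (j + i)))))"
        by (rule sum.reindex_bij_witness[of _ "\<lambda>j. m + j" "\<lambda>j. j - m"]) (auto simp: mult_ac)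
      then show ?thesis
        using less.prems(1)
        by (simp add: mgev_J_unfold[of "n - m"] erlang_tail_def right_diff_distrib sum_distrib_left)
    qed
    have sum_nonneg: "0 \<le> (\<Sum>j\<in>{m<..<n}. ?s j)"
      by (intro sum_nonneg s_nonneg)
    have "ennreal (\<Sum>j\<in>{m<..<n}. ?s j) \<le> ennreal (erlang_tail (n - m) (b n))"
      unfolding total by simp
    then have le: "(\<Sum>j\<in>{m<..<n}. ?s j) \<le> erlang_tail (n - m) (b n)"
      using less.prems(1) erlang_tail_pos[of "n - m" "b n"] b[OF n] by (subst (asm) ennreal_le_iff) (auto simp: Suc_le_eq)
    have "dominating_integral m n b = ennreal (erlang_tail (n - m) (b n)) - ennreal (\<Sum>j\<in>{m<..<n}. ?s j)"
      unfolding total by simp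
    also have "\<dots> = ennreal (exp (- b n) * mgev_J (n - m) (\<lambda>i. b (m + i)))"
      unfolding J using sum_nonneg by (rule ennreal_minus)
    finally have "dominating_integral m n b = ennreal (exp (- b n) * mgev_J (n - m) (\<lambda>i. b (m + i)))" .
    moreover have "0 \<le> exp (- b n) * mgev_J (n - m) (\<lambda>i. b (m + i))"
      unfolding J using le by simp
    ultimately show ?case
      by (simp add: zero_le_mult_iff)
  qed
  then show "mgev_J (n - m) (\<lambda>i. b (m + i)) \<ge> 0"
    and "dominating_integral m n b = ennreal (exp (- b n) * mgev_J (n - m) (\<lambda>i. b (m + i)))"
    by auto
qed

section \<open>Passing from MGEV vectors to increasing vectors\<close>

text \<open>
  The values on intervals \<open>{a..b}\<close> away from the origin suffice: they give the mass of
  \<open>{..x}\<close> as a limit along \<open>a \<longlonglongrightarrow> 0\<close>. In this form the criterion only calls for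
  integrals over compact subsets of the support, which matters because \<open>\<Lambda>\<close> need not be
  differentiable at the end point of the support.
\<close>

lemma half_line_eqI:
  fixes P :: "real measure"
  assumes sets: "sets P = sets borel" and null: "emeasure P {..0} = 0"
    and Icc: "\<And>a b. 0 < a \<Longrightarrow> a \<le> b \<Longrightarrow> emeasure P {a..b} = ennreal (b - a)"
  shows "P = half_line"
proof -
  have cdf: "emeasure Q {..x} = ennreal x"
    if "sets Q = sets borel" "emeasure Q {..0} = 0"
      and Icc: "\<And>a b. 0 < a \<Longrightarrow> a \<le> b \<Longrightarrow> emeasure Q {a..b} = ennreal (b - a)"
    for Q :: "real measure" and x
  proof (cases "x > 0")
    case False
    have "emeasure Q {..x} \<le> emeasure Q {..0}"
      using False that(1) by (intro emeasure_mono) simp_all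
    then show ?thesis
      using that(2) False by (simp add: ennreal_neg)
  next
    case True
    have "(\<lambda>n. emeasure Q {x / (real n + 1)..x}) \<longlonglongrightarrow> emeasure Q (\<Union>n. {x / (real n + 1)..x})"
    proof (rule Lim_emeasure_incseq)
      show "range (\<lambda>n. {x / (real n + 1)..x}) \<subseteq> sets Q"
        by (auto simp: that(1))
      show "incseq (\<lambda>n. {x / (real n + 1)..x})"
      proof (rule incseq_SucI)
        fix n
        have "x / (real (Suc n) + 1) \<le> x / (real n + 1)"
          using True by (intro frac_le) simp_all
        then show "{x / (real n + 1)..x} \<subseteq> {x / (real (Suc n) + 1)..x}"
          by auto
      qed
    qed
    moreover have "emeasure Q {x / (real n + 1)..x} = ennreal (x - x / (real n + 1))" for n
      using True by (intro Icc) (auto simp: field_simps)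
    moreover have "(\<lambda>n. ennreal (x - x / (real n + 1))) \<longlonglongrightarrow> ennreal (x - 0)"
    proof (intro tendsto_ennrealI tendsto_diff tendsto_const)
      show "(\<lambda>n. x / (real n + 1)) \<longlonglongrightarrow> 0"
        using LIMSEQ_Suc[OF lim_const_over_n[of x]] by (simp add: add.commute)
    qed
    ultimately have "emeasure Q (\<Union>n. {x / (real n + 1)..x}) = ennreal x"
      using LIMSEQ_unique by fastforce
    moreover have "(\<Union>n. {x / (real n + 1)..x}) = {0<..x}"
    proof safe
      fix y n assume "y \<in> {x / (real n + 1)..x}"
      moreover have "0 < x / (real n + 1)" using True by simp
      ultimately show "y \<in> {0<..x}" by (simp add: less_le_trans)
    next
      fix y assume y: "y \<in> {0<..x}"
      obtain n where "x / y < real n"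
        using reals_Archimedean2 by blast
      then have "x / (real n + 1) \<le> y"
        using y by (simp add: field_simps)
      then show "y \<in> (\<Union>n. {x / (real n + 1)..x})"
        using y by auto
    qed
    moreover have "emeasure Q {..x} = emeasure Q ({..0} \<union> {0<..x})"
      using True by (intro arg_cong[where f = "emeasure Q"]) auto
    moreover have "\<dots> = emeasure Q {..0} + emeasure Q {0<..x}"
      using that(1) by (intro plus_emeasure[symmetric]) auto
    ultimately show ?thesis
      using that(2) by simp
  qed
  have "emeasure half_line {..0} = (\<integral>\<^sup>+ t. indicator {0<..} t * indicator {..0} t \<partial>(lborel :: real measure))"
    unfolding half_line_def by (rule emeasure_density) auto
  also have "\<dots> = (\<integral>\<^sup>+ t. 0 \<partial>(lborel :: real measure))"
    by (intro nn_integral_cong) (auto simp: indicator_def)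
  finally have hl_null: "emeasure half_line {..0} = 0" by simp
  have hl_Icc: "emeasure half_line {a..b} = ennreal (b - a)" if "0 < a" "a \<le> b" for a b
  proof -
    have "emeasure half_line {a..b} = (\<integral>\<^sup>+ t. indicator {0<..} t * indicator {a..b} t \<partial>lborel)"
      unfolding half_line_def by (rule emeasure_density) auto
    also have "\<dots> = (\<integral>\<^sup>+ t. indicator {a..b} t \<partial>lborel)"
      using that by (intro nn_integral_cong) (auto simp: indicator_def)
    finally show ?thesis using that by simp
  qed
  show ?thesis
  proof (rule measure_eqI_generator_eq[where \<Omega> = UNIV and E = "range atMost" and A = "\<lambda>n. {..real n}"])
    show "Int_stable (range atMost :: real set set)"
      by (auto simp: Int_stable_def)
    show "emeasure P X = emeasure half_line X" if "X \<in> range atMost" for X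
      using that cdf[OF sets null Icc] cdf[OF sets_half_line hl_null hl_Icc] by auto
    have "sets borel = sigma_sets UNIV (range atMost :: real set set)"
      unfolding borel_eq_atMost by simp
    then show "sets P = sigma_sets UNIV (range atMost)" "sets half_line = sigma_sets UNIV (range atMost)"
      using sets by simp_all
    show "(\<Union>n. {..real n}) = UNIV"
      using real_arch_simple by auto
    show "emeasure P {..real n} \<noteq> \<infinity>" for n
      by (subst cdf[OF sets null Icc]) auto
  qed auto
qed

text \<open>
  The set on which \<open>\<Lambda>\<close> is meant to be used; for \<open>\<xi> = 0\<close> the condition holds everywhere.
\<close>

definition gev_support :: "real \<Rightarrow> real \<Rightarrow> real \<Rightarrow> real set" where
  "gev_support \<mu> \<sigma> \<xi> = {z. 0 < 1 + \<xi> * ((z - \<mu>) / \<sigma>)}"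

text \<open>
  The function \<open>- \<Lambda>'\<close> on the support, in a form that covers \<open>\<xi> = 0\<close> and \<open>\<xi> \<noteq> 0\<close> at once.
\<close>

definition gev_weight :: "real \<Rightarrow> real \<Rightarrow> real \<Rightarrow> real \<Rightarrow> real" where
  "gev_weight \<mu> \<sigma> \<xi> z = (if z \<in> gev_support \<mu> \<sigma> \<xi>
     then mgev_Lambda \<mu> \<sigma> \<xi> z / (\<sigma> * (1 + \<xi> * ((z - \<mu>) / \<sigma>))) else 0)"

lemma mgev_Lambda_pos: "z \<in> gev_support \<mu> \<sigma> \<xi> \<Longrightarrow> 0 < mgev_Lambda \<mu> \<sigma> \<xi> z"
  by (auto simp: mgev_Lambda_def gev_support_def)

lemma gev_weight_pos: "\<sigma> > 0 \<Longrightarrow> z \<in> gev_support \<mu> \<sigma> \<xi> \<Longrightarrow> 0 < gev_weight \<mu> \<sigma> \<xi> z"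
  using mgev_Lambda_pos by (simp add: gev_weight_def gev_support_def)

lemma mgev_Lambda_deriv:
  assumes "\<sigma> > 0" "z \<in> gev_support \<mu> \<sigma> \<xi>"
  shows "(mgev_Lambda \<mu> \<sigma> \<xi> has_real_derivative - gev_weight \<mu> \<sigma> \<xi> z) (at z)"
proof (cases "\<xi> = 0")
  case True
  then have "mgev_Lambda \<mu> \<sigma> \<xi> = (\<lambda>z. exp (- ((z - \<mu>) / \<sigma>)))"
    by (auto simp: mgev_Lambda_def)
  moreover have "((\<lambda>z. exp (- ((z - \<mu>) / \<sigma>))) has_real_derivative - gev_weight \<mu> \<sigma> \<xi> z) (at z)"
    using assms True by (auto intro!: derivative_eq_intros simp: gev_weight_def gev_support_def mgev_Lambda_def)
  ultimately show ?thesis by simp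
next
  case False
  define y where "y = 1 + \<xi> * ((z - \<mu>) / \<sigma>)"
  have y: "y > 0" using assms(2) by (simp add: gev_support_def y_def)
  have "\<sigma> \<noteq> 0" using assms(1) by simp
  have fn: "mgev_Lambda \<mu> \<sigma> \<xi> = (\<lambda>z. (1 + \<xi> * ((z - \<mu>) / \<sigma>)) powr (- 1 / \<xi>))"
    using False by (auto simp: mgev_Lambda_def)
  have "((\<lambda>z. (1 + \<xi> * ((z - \<mu>) / \<sigma>)) powr (- 1 / \<xi>)) has_real_derivative
      (- 1 / \<xi>) * y powr (- 1 / \<xi> - 1) * (\<xi> / \<sigma>)) (at z)"
    using y \<open>\<sigma> \<noteq> 0\<close> False by (auto intro!: derivative_eq_intros simp: y_def)
  also have "(- 1 / \<xi>) * y powr (- 1 / \<xi> - 1) * (\<xi> / \<sigma>) = - gev_weight \<mu> \<sigma> \<xi> z"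
  proof -
    have "gev_weight \<mu> \<sigma> \<xi> z = y powr (- 1 / \<xi>) / (\<sigma> * y)"
      using assms(2) by (simp only: gev_weight_def fn y_def if_True)
    then show ?thesis
      using y False by (simp add: powr_diff)
  qed
  finally show ?thesis by (simp add: fn)
qed

lemma gev_support_convex:
  assumes "z1 \<in> gev_support \<mu> \<sigma> \<xi>" "z2 \<in> gev_support \<mu> \<sigma> \<xi>" "z1 \<le> z" "z \<le> z2" "\<sigma> > 0"
  shows "z \<in> gev_support \<mu> \<sigma> \<xi>"
proof (cases "\<xi> \<ge> 0")
  case True
  have "\<xi> * ((z1 - \<mu>) / \<sigma>) \<le> \<xi> * ((z - \<mu>) / \<sigma>)"
    using assms True by (intro mult_left_mono divide_right_mono) auto
  with assms(1) show ?thesis by (simp add: gev_support_def)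
next
  case False
  have "\<xi> * ((z2 - \<mu>) / \<sigma>) \<le> \<xi> * ((z - \<mu>) / \<sigma>)"
    using assms False by (intro mult_left_mono_neg divide_right_mono) auto
  with assms(2) show ?thesis by (simp add: gev_support_def)
qed

lemma mgev_Lambda_less_iff:
  assumes "\<sigma> > 0" "z1 \<in> gev_support \<mu> \<sigma> \<xi>" "z2 \<in> gev_support \<mu> \<sigma> \<xi>"
  shows "mgev_Lambda \<mu> \<sigma> \<xi> z2 < mgev_Lambda \<mu> \<sigma> \<xi> z1 \<longleftrightarrow> z1 < z2"
proof -
  have less: "mgev_Lambda \<mu> \<sigma> \<xi> b < mgev_Lambda \<mu> \<sigma> \<xi> a"
    if "a < b" "a \<in> gev_support \<mu> \<sigma> \<xi>" "b \<in> gev_support \<mu> \<sigma> \<xi>" for a b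
  proof (rule DERIV_neg_imp_decreasing[OF that(1)])
    fix x assume "a \<le> x" "x \<le> b"
    then have "x \<in> gev_support \<mu> \<sigma> \<xi>"
      using that assms(1) gev_support_convex by blast
    then show "\<exists>y. (mgev_Lambda \<mu> \<sigma> \<xi> has_real_derivative y) (at x) \<and> y < 0"
      using mgev_Lambda_deriv gev_weight_pos assms(1) by (metis neg_less_0_iff_less)
  qed
  show ?thesis
    using less assms by (metis less_asym linorder_neqE_linordered_idom)
qed

lemma mgev_Lambda_surj:
  assumes "\<sigma> > 0" "t > 0"
  obtains z where "z \<in> gev_support \<mu> \<sigma> \<xi>" "mgev_Lambda \<mu> \<sigma> \<xi> z = t"
proof (cases "\<xi> = 0")
  case True
  then show ?thesis
    using assms by (intro that[of "\<mu> - \<sigma> * ln t"]) (auto simp: gev_support_def mgev_Lambda_def)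
next
  case False
  have "1 + \<xi> * ((\<mu> + \<sigma> * ((t powr (- \<xi>) - 1) / \<xi>) - \<mu>) / \<sigma>) = t powr (- \<xi>)"
    using assms False by simp
  then show ?thesis
    using assms False
    by (intro that[of "\<mu> + \<sigma> * ((t powr (- \<xi>) - 1) / \<xi>)"])
      (auto simp: gev_support_def mgev_Lambda_def powr_powr)
qed

lemma gev_support_measurable [measurable]: "gev_support \<mu> \<sigma> \<xi> \<in> sets borel"
  unfolding gev_support_def by measurable

lemma mgev_Lambda_measurable [measurable]: "mgev_Lambda \<mu> \<sigma> \<xi> \<in> borel_measurable borel"
  unfolding mgev_Lambda_def by measurable

lemma gev_weight_measurable [measurable]: "gev_weight \<mu> \<sigma> \<xi> \<in> borel_measurable borel"
  unfolding gev_weight_def by measurable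

text \<open>
  Substitution \<open>t = \<Lambda>(z)\<close>: \<open>\<Lambda>\<close> maps the support decreasingly onto the positive reals, and the
  weight integrates to \<open>b - a\<close> over the preimage of \<open>{a..b}\<close>.
\<close>

lemma distr_mgev_Lambda:
  assumes "\<sigma> > 0"
  shows "distr (density lborel (\<lambda>z. ennreal (gev_weight \<mu> \<sigma> \<xi> z))) half_line (mgev_Lambda \<mu> \<sigma> \<xi>) = half_line"
    (is "distr ?N _ ?L = _")
proof (rule half_line_eqI)
  have em: "emeasure (distr ?N half_line ?L) A
      = (\<integral>\<^sup>+ z. ennreal (gev_weight \<mu> \<sigma> \<xi> z) * indicator (?L -` A) z \<partial>lborel)"
    if [measurable]: "A \<in> sets borel" for A
  proof -
    have "emeasure (distr ?N half_line ?L) A = emeasure ?N (?L -` A)"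
      by (subst emeasure_distr) auto
    also have "\<dots> = (\<integral>\<^sup>+ z. ennreal (gev_weight \<mu> \<sigma> \<xi> z) * indicator (?L -` A) z \<partial>lborel)"
      using measurable_sets[OF mgev_Lambda_measurable that, of \<mu> \<sigma> \<xi>]
      by (intro emeasure_density) auto
    finally show ?thesis .
  qed
  have "emeasure (distr ?N half_line ?L) {..0} = (\<integral>\<^sup>+ (z::real). 0 \<partial>lborel)"
  proof (subst em, simp, rule nn_integral_cong)
    fix z
    show "ennreal (gev_weight \<mu> \<sigma> \<xi> z) * indicator (?L -` {..0}) z = 0"
      using mgev_Lambda_pos[of z \<mu> \<sigma> \<xi>]
      by (cases "z \<in> gev_support \<mu> \<sigma> \<xi>") (simp_all add: gev_weight_def not_le)
  qed
  then show "emeasure (distr ?N half_line ?L) {..0} = 0" by simp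
  fix a b :: real assume ab: "0 < a" "a \<le> b"
  \<comment> \<open>As \<open>\<Lambda>\<close> is decreasing, the preimage of \<open>{a..b}\<close> runs from \<open>\<Lambda>\<^sup>-\<^sup>1(b)\<close> to \<open>\<Lambda>\<^sup>-\<^sup>1(a)\<close>.\<close>
  obtain za where za: "za \<in> gev_support \<mu> \<sigma> \<xi>" "?L za = a"
    using mgev_Lambda_surj[OF assms ab(1)] .
  obtain zb where zb: "zb \<in> gev_support \<mu> \<sigma> \<xi>" "?L zb = b"
    using mgev_Lambda_surj[OF assms, of b \<mu> \<xi>] ab by auto
  have le: "zb \<le> za"
    using mgev_Lambda_less_iff[OF assms za(1) zb(1)] za zb ab by auto
  have "emeasure (distr ?N half_line ?L) {a..b}
      = (\<integral>\<^sup>+ z. ennreal (gev_weight \<mu> \<sigma> \<xi> z) * indicator {zb..za} z \<partial>lborel)"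
  proof (subst em, simp, rule nn_integral_cong)
    fix z :: real
    show "ennreal (gev_weight \<mu> \<sigma> \<xi> z) * indicator (?L -` {a..b}) z =
        ennreal (gev_weight \<mu> \<sigma> \<xi> z) * indicator {zb..za} z"
    proof (cases "z \<in> gev_support \<mu> \<sigma> \<xi>")
      case True
      have "a \<le> ?L z \<longleftrightarrow> z \<le> za" "?L z \<le> b \<longleftrightarrow> zb \<le> z"
        using mgev_Lambda_less_iff[OF assms za(1) True] mgev_Lambda_less_iff[OF assms True zb(1)]
        unfolding za(2) zb(2) by linarith+
      then show ?thesis by (simp add: indicator_def conj_commute)
    qed (simp add: gev_weight_def)
  qed
  also have "\<dots> = ennreal (- ?L za - - ?L zb)"
  proof (rule nn_integral_FTC_Icc[where F = "\<lambda>z. - ?L z", OF _ _ _ le])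
    fix z assume "z \<in> {zb..za}"
    then have "z \<in> gev_support \<mu> \<sigma> \<xi>"
      using gev_support_convex[OF zb(1) za(1)] assms by auto
    then show "((\<lambda>z. - ?L z) has_real_derivative gev_weight \<mu> \<sigma> \<xi> z) (at z)"
      "0 \<le> gev_weight \<mu> \<sigma> \<xi> z"
      using DERIV_minus[OF mgev_Lambda_deriv[OF assms]] gev_weight_pos[OF assms]
      by (simp_all add: less_imp_le)
  qed measurable
  finally show "emeasure (distr ?N half_line ?L) {a..b} = ennreal (b - a)"
    using za zb by simp
qed simp

text \<open>
  One-dimensional changes of variables combine to one on the product; it suffices to compare the two
  measures on boxes, where both are products.
\<close>

lemma (in product_sigma_finite) distr_density_PiM:
  assumes fin: "finite I"
    and f: "\<And>i. i \<in> I \<Longrightarrow> f i \<in> borel_measurable (M i)"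
    and T: "\<And>i. i \<in> I \<Longrightarrow> T i \<in> measurable (M i) (N i)"
    and N: "product_sigma_finite N"
    and distr: "\<And>i. i \<in> I \<Longrightarrow> distr (density (M i) (f i)) (N i) (T i) = N i"
  shows "distr (density (Pi\<^sub>M I M) (\<lambda>x. \<Prod>i\<in>I. f i (x i))) (Pi\<^sub>M I N) (\<lambda>x. \<lambda>i\<in>I. T i (x i)) = Pi\<^sub>M I N"
proof (rule product_sigma_finite.PiM_eqI[OF N fin])
  have T': "(\<lambda>x. \<lambda>i\<in>I. T i (x i)) \<in> measurable (Pi\<^sub>M I M) (Pi\<^sub>M I N)"
    using T by (intro measurable_restrict) (auto intro!: measurable_compose[OF measurable_component_singleton])
  have f': "(\<lambda>x. \<Prod>i\<in>I. f i (x i)) \<in> borel_measurable (Pi\<^sub>M I M)"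
    using f by (intro borel_measurable_prod_ennreal) (auto intro!: measurable_compose[OF measurable_component_singleton])
  fix A assume A: "\<And>i. i \<in> I \<Longrightarrow> A i \<in> sets (N i)"
  have TA: "T i -` A i \<inter> space (M i) \<in> sets (M i)" if "i \<in> I" for i
    using measurable_sets[OF T[OF that] A[OF that]] .
  have PA: "Pi\<^sub>E I A \<in> sets (Pi\<^sub>M I N)"
    using A fin by (intro sets_PiM_I_finite)
  let ?S = "(\<lambda>x. \<lambda>i\<in>I. T i (x i)) -` Pi\<^sub>E I A \<inter> space (Pi\<^sub>M I M)"
  have "emeasure (distr (density (Pi\<^sub>M I M) (\<lambda>x. \<Prod>i\<in>I. f i (x i))) (Pi\<^sub>M I N) (\<lambda>x. \<lambda>i\<in>I. T i (x i))) (Pi\<^sub>E I A)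
      = emeasure (density (Pi\<^sub>M I M) (\<lambda>x. \<Prod>i\<in>I. f i (x i))) ?S"
    using T' PA by (subst emeasure_distr) auto
  also have "\<dots> = (\<integral>\<^sup>+ x. (\<Prod>i\<in>I. f i (x i)) * indicator ?S x \<partial>Pi\<^sub>M I M)"
    using f' measurable_sets[OF T' PA] by (rule emeasure_density)
  also have "\<dots> = (\<integral>\<^sup>+ x. (\<Prod>i\<in>I. f i (x i) * indicator (T i -` A i \<inter> space (M i)) (x i)) \<partial>Pi\<^sub>M I M)"
  proof (rule nn_integral_cong)
    fix x assume x: "x \<in> space (Pi\<^sub>M I M)"
    have "(\<Prod>i\<in>I. indicator (T i -` A i \<inter> space (M i)) (x i)) = (indicator ?S x :: ennreal)"
    proof (cases "x \<in> ?S")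
      case True
      then have "indicator (T i -` A i \<inter> space (M i)) (x i) = (1::ennreal)" if "i \<in> I" for i
        using that by (auto simp: PiE_iff space_PiM)
      then show ?thesis using True by simp
    next
      case False
      then obtain i where "i \<in> I" "x i \<notin> T i -` A i"
        using x by (auto simp: PiE_iff)
      then have "(\<Prod>i\<in>I. indicator (T i -` A i \<inter> space (M i)) (x i)) = (0::ennreal)"
        using fin by (intro prod_zero bexI[of _ i]) auto
      then show ?thesis using False by simp
    qed
    then show "(\<Prod>i\<in>I. f i (x i)) * indicator ?S x
        = (\<Prod>i\<in>I. f i (x i) * indicator (T i -` A i \<inter> space (M i)) (x i))"
      by (simp add: prod.distrib)
  qed
  also have "\<dots> = (\<Prod>i\<in>I. \<integral>\<^sup>+ x. f i x * indicator (T i -` A i \<inter> space (M i)) x \<partial>M i)"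
    using f TA by (intro product_nn_integral_prod fin) auto
  also have "\<dots> = (\<Prod>i\<in>I. emeasure (N i) (A i))"
  proof (intro prod.cong refl)
    fix i assume i: "i \<in> I"
    have "emeasure (N i) (A i) = emeasure (density (M i) (f i)) (T i -` A i \<inter> space (M i))"
      using T[OF i] A[OF i] by (subst distr[OF i, symmetric], subst emeasure_distr) auto
    also have "\<dots> = (\<integral>\<^sup>+ x. f i x * indicator (T i -` A i \<inter> space (M i)) x \<partial>M i)"
      using f[OF i] TA[OF i] by (rule emeasure_density)
    finally show "(\<integral>\<^sup>+ x. f i x * indicator (T i -` A i \<inter> space (M i)) x \<partial>M i) = emeasure (N i) (A i)" ..
  qed
  finally show "emeasure (distr (density (Pi\<^sub>M I M) (\<lambda>x. \<Prod>i\<in>I. f i (x i))) (Pi\<^sub>M I N) (\<lambda>x. \<lambda>i\<in>I. T i (x i))) (Pi\<^sub>E I A)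
      = (\<Prod>i\<in>I. emeasure (N i) (A i))" .
qed simp

section \<open>Marginals and copula of the MGEV distribution\<close>

lemma gev_support_iff:
  assumes "\<sigma> > 0"
  shows "z \<in> gev_support \<mu> \<sigma> \<xi> \<longleftrightarrow>
    (\<xi> > 0 \<longrightarrow> z > \<mu> - \<sigma> / \<xi>) \<and> (\<xi> < 0 \<longrightarrow> \<mu> - \<sigma> / \<xi> > z)"
proof (cases \<xi> "0 :: real" rule: linorder_cases)
  case less
  have "0 < 1 + \<xi> * ((z - \<mu>) / \<sigma>) \<longleftrightarrow> \<mu> - \<sigma> / \<xi> > z"
    using assms less by (simp add: field_simps)
  then show ?thesis using less by (simp add: gev_support_def)
next
  case greater
  have "0 < 1 + \<xi> * ((z - \<mu>) / \<sigma>) \<longleftrightarrow> z > \<mu> - \<sigma> / \<xi>"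
    using assms greater by (simp add: field_simps)
  then show ?thesis using greater by (simp add: gev_support_def)
qed (simp add: gev_support_def)

text \<open>
  Membership in \<open>\<Omega>\<close> bounds only one extreme coordinate by the end point of the support. As the
  coordinates decrease, the others are then in the support too, and \<open>\<Lambda>\<close> reverses their order.
\<close>

lemma mgev_Omega_iff:
  assumes "\<sigma> > 0" "K \<ge> 1"
  shows "z \<in> mgev_Omega K \<mu> \<sigma> \<xi> \<longleftrightarrow>
    (\<forall>i\<in>{0<..K}. z i \<in> gev_support \<mu> \<sigma> \<xi>) \<and> increasing 0 K (\<lambda>i. mgev_Lambda \<mu> \<sigma> \<xi> (z i))"
    (is "_ \<longleftrightarrow> ?S \<and> ?inc")
proof -
  have K: "{1..<K} = {0<..<K}" "1 \<in> {0<..K}" "K \<in> {0<..K}"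
    using assms by auto
  have support: "z \<in> mgev_Omega K \<mu> \<sigma> \<xi> \<Longrightarrow> ?S"
  proof
    fix i assume z: "z \<in> mgev_Omega K \<mu> \<sigma> \<xi>" and i: "i \<in> {0<..K}"
    then have dec: "increasing 0 K (\<lambda>i. - z i)"
      by (simp add: increasing_def mgev_Omega_def K)
    have "z K \<le> z i"
      using increasing_less[OF dec, of i K] i by (cases "i = K") auto
    moreover have "z i \<le> z 1"
      using increasing_less[OF dec, of 1 i] i by (cases "i = 1") auto
    ultimately show "z i \<in> gev_support \<mu> \<sigma> \<xi>"
      using z by (auto simp: gev_support_iff[OF assms(1)] mgev_Omega_def)
  qed
  have order: "?inc \<longleftrightarrow> (\<forall>i\<in>{1..<K}. z i > z (Suc i))" if ?S
    unfolding increasing_def K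
    using that by (intro ball_cong refl mgev_Lambda_less_iff[OF assms(1)]) auto
  show ?thesis
  proof
    assume z: "z \<in> mgev_Omega K \<mu> \<sigma> \<xi>"
    then show "?S \<and> ?inc"
      using support order by (simp add: mgev_Omega_def)
  next
    assume *: "?S \<and> ?inc"
    then show "z \<in> mgev_Omega K \<mu> \<sigma> \<xi>"
      using order K(2,3) by (auto simp: mgev_Omega_def gev_support_iff[OF assms(1)])
  qed
qed

text \<open>
  The sign \<open>(-1)\<^sup>K\<close> makes every factor \<open>- \<Lambda>'\<close>, so the density is the product of the weights times
  a function of \<open>\<Lambda>(z\<^sub>1), \<dots>, \<Lambda>(z\<^sub>K)\<close> alone. That vector is restricted to \<open>{0<..K}\<close>
  to be a point of the product space.
\<close>

lemma mgev_density_eq: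
  assumes "\<sigma> > 0" "K \<ge> 1"
  shows "ennreal (mgev_density K \<mu> \<sigma> \<xi> z) = (\<Prod>i\<in>{0<..K}. ennreal (gev_weight \<mu> \<sigma> \<xi> (z i))) *
    (if increasing 0 K (\<lambda>i\<in>{0<..K}. mgev_Lambda \<mu> \<sigma> \<xi> (z i))
     then ennreal (exp (- (\<lambda>i\<in>{0<..K}. mgev_Lambda \<mu> \<sigma> \<xi> (z i)) K)) else 0)"
proof -
  have K: "{1..K} = {0<..K}" "K \<in> {0<..K}" using assms by auto
  have restrict: "increasing 0 K (\<lambda>i\<in>{0<..K}. mgev_Lambda \<mu> \<sigma> \<xi> (z i)) \<longleftrightarrow>
      increasing 0 K (\<lambda>i. mgev_Lambda \<mu> \<sigma> \<xi> (z i))"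
    by (simp add: increasing_def)
  show ?thesis
  proof (cases "\<forall>i\<in>{0<..K}. z i \<in> gev_support \<mu> \<sigma> \<xi>")
    case False
    then obtain i where "i \<in> {0<..K}" "gev_weight \<mu> \<sigma> \<xi> (z i) = 0"
      by (auto simp: gev_weight_def)
    then have "(\<Prod>i\<in>{0<..K}. ennreal (gev_weight \<mu> \<sigma> \<xi> (z i))) = 0"
      by (intro prod_zero bexI[of _ i]) auto
    moreover have "z \<notin> mgev_Omega K \<mu> \<sigma> \<xi>"
      using False mgev_Omega_iff[OF assms] by blast
    ultimately show ?thesis by (simp add: mgev_density_def)
  next
    case True
    have weight: "deriv (mgev_Lambda \<mu> \<sigma> \<xi>) (z j) = - gev_weight \<mu> \<sigma> \<xi> (z j)"
      "0 \<le> gev_weight \<mu> \<sigma> \<xi> (z j)" if "j \<in> {0<..K}" for j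
      using True that mgev_Lambda_deriv[OF assms(1)] gev_weight_pos[OF assms(1)]
      by (auto intro: DERIV_imp_deriv less_imp_le)
    have "(\<Prod>j\<in>{0<..K}. deriv (mgev_Lambda \<mu> \<sigma> \<xi>) (z j)) = (\<Prod>j\<in>{0<..K}. - gev_weight \<mu> \<sigma> \<xi> (z j))"
      by (intro prod.cong refl weight)
    also have "\<dots> = (- 1) ^ K * (\<Prod>j\<in>{0<..K}. gev_weight \<mu> \<sigma> \<xi> (z j))"
      by (simp add: prod_uminus)
    finally have sign: "(- 1) ^ K * exp (- mgev_Lambda \<mu> \<sigma> \<xi> (z K)) * (\<Prod>j\<in>{0<..K}. deriv (mgev_Lambda \<mu> \<sigma> \<xi>) (z j))
        = (\<Prod>j\<in>{0<..K}. gev_weight \<mu> \<sigma> \<xi> (z j)) * exp (- mgev_Lambda \<mu> \<sigma> \<xi> (z K))"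
      by simp
    have product: "ennreal ((\<Prod>j\<in>{0<..K}. gev_weight \<mu> \<sigma> \<xi> (z j)) * exp (- mgev_Lambda \<mu> \<sigma> \<xi> (z K)))
        = (\<Prod>j\<in>{0<..K}. ennreal (gev_weight \<mu> \<sigma> \<xi> (z j))) * ennreal (exp (- mgev_Lambda \<mu> \<sigma> \<xi> (z K)))"
      using weight(2) by (subst prod_ennreal) (auto simp: ennreal_mult'')
    have "mgev_density K \<mu> \<sigma> \<xi> z = (if increasing 0 K (\<lambda>i. mgev_Lambda \<mu> \<sigma> \<xi> (z i))
        then (\<Prod>j\<in>{0<..K}. gev_weight \<mu> \<sigma> \<xi> (z j)) * exp (- mgev_Lambda \<mu> \<sigma> \<xi> (z K)) else 0)"
      unfolding mgev_density_def mgev_Omega_iff[OF assms] K(1) sign using True by simp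
    then show ?thesis
      unfolding restrict using K(2) by (simp add: product)
  qed
qed

context
  fixes K :: nat and \<mu> \<sigma> \<xi> :: real
  assumes K: "K \<ge> 1" and \<sigma>: "\<sigma> > 0"
begin

private abbreviation (input) "M \<equiv> mgev K \<mu> \<sigma> \<xi>"
private abbreviation (input) "Lam \<equiv> mgev_Lambda \<mu> \<sigma> \<xi>"
private abbreviation (input) "Lams \<equiv> \<lambda>z. \<lambda>i\<in>{0<..K}. Lam (z i)"

lemma K_interval: "{1..K} = {0<..K}" "K \<in> {0<..K}"
  using K by auto

lemma Lams_measurable [measurable]: "Lams \<in> measurable (Pi\<^sub>M {0<..K} (\<lambda>_. lborel)) (half_space 0 K)"
  by (intro measurable_restrict) (auto intro!: measurable_compose[OF measurable_component_singleton])

lemma sets_mgev [measurable_cong]: "sets M = sets (Pi\<^sub>M {0<..K} (\<lambda>_. lborel))"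
  unfolding mgev_def K_interval by simp

lemma order_statistic_density_measurable:
  "(\<lambda>t. if increasing 0 K t then ennreal (exp (- t K)) else 0) \<in> borel_measurable (half_space 0 K)"
proof -
  have [measurable]: "(\<lambda>t. t K) \<in> borel_measurable (half_space 0 K)"
    using K measurable_component_singleton[of K "{0<..K}" "\<lambda>_. half_line"] by auto
  show ?thesis by measurable
qed

lemma prod_weight_measurable:
  "(\<lambda>z. \<Prod>i\<in>{0<..K}. ennreal (gev_weight \<mu> \<sigma> \<xi> (z i))) \<in> borel_measurable (Pi\<^sub>M {0<..K} (\<lambda>_. lborel))"
  by (intro borel_measurable_prod_ennreal) (auto intro!: measurable_compose[OF measurable_component_singleton])

lemma mgev_density_measurable:
  "(\<lambda>z. ennreal (mgev_density K \<mu> \<sigma> \<xi> z)) \<in> borel_measurable (Pi\<^sub>M {0<..K} (\<lambda>_. lborel))"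
  unfolding mgev_density_eq[OF \<sigma> K]
  by (intro borel_measurable_times_ennreal prod_weight_measurable
      measurable_compose[OF Lams_measurable order_statistic_density_measurable])

text \<open>
  If \<open>Z\<close> is MGEV distributed, \<open>(\<Lambda>(Z\<^sub>1), \<dots>, \<Lambda>(Z\<^sub>K))\<close> has density \<open>exp (- t K)\<close> on the increasing
  vectors of positive reals: it is distributed as the first \<open>K\<close> points of a unit rate Poisson
  process. The parameters of the distribution disappear here.
\<close>

lemma nn_integral_mgev:
  assumes F: "F \<in> borel_measurable (half_space 0 K)"
  shows "(\<integral>\<^sup>+ z. F (Lams z) \<partial>M) =
    (\<integral>\<^sup>+ t. (if increasing 0 K t then ennreal (exp (- t K)) else 0) * F t \<partial>half_space 0 K)"
proof -
  let ?B = "Pi\<^sub>M {0<..K} (\<lambda>_. lborel :: real measure)"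
  let ?w = "\<lambda>z. \<Prod>i\<in>{0<..K}. ennreal (gev_weight \<mu> \<sigma> \<xi> (z i))"
  let ?g = "\<lambda>t. if increasing 0 K t then ennreal (exp (- t K)) else 0"
  let ?h = "\<lambda>t. ?g t * F t"
  interpret B: product_sigma_finite "\<lambda>_::nat. lborel :: real measure" ..
  have h: "?h \<in> borel_measurable (half_space 0 K)"
    by (intro borel_measurable_times_ennreal order_statistic_density_measurable F)
  have law: "distr (density ?B ?w) (half_space 0 K) Lams = half_space 0 K"
    using \<sigma> by (intro B.distr_density_PiM distr_mgev_Lambda hl.product_sigma_finite_axioms) auto
  have "(\<integral>\<^sup>+ z. F (Lams z) \<partial>M) = (\<integral>\<^sup>+ z. ennreal (mgev_density K \<mu> \<sigma> \<xi> z) * F (Lams z) \<partial>?B)"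
    unfolding mgev_def K_interval
    by (intro nn_integral_density mgev_density_measurable measurable_compose[OF Lams_measurable F])
  also have "\<dots> = (\<integral>\<^sup>+ z. ?w z * ?h (Lams z) \<partial>?B)"
    by (simp only: mgev_density_eq[OF \<sigma> K] mult.assoc)
  also have "\<dots> = (\<integral>\<^sup>+ z. ?h (Lams z) \<partial>density ?B ?w)"
    by (intro nn_integral_density[symmetric] prod_weight_measurable measurable_compose[OF Lams_measurable h])
  also have "\<dots> = (\<integral>\<^sup>+ t. ?h t \<partial>distr (density ?B ?w) (half_space 0 K) Lams)"
  proof (rule nn_integral_distr[symmetric])
    show "Lams \<in> measurable (density ?B ?w) (half_space 0 K)"
      using Lams_measurable unfolding measurable_density_eq1 .
    show "?h \<in> borel_measurable (distr (density ?B ?w) (half_space 0 K) Lams)"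
      using h by simp
  qed
  finally show ?thesis unfolding law .
qed

lemma lower_bounds_event_measurable:
  "{z \<in> space M. \<forall>i\<in>{0<..K}. b i \<le> Lam (z i)} \<in> sets M"
proof -
  have "{z \<in> space M. \<forall>i\<in>{0<..K}. b i \<le> Lam (z i)} =
      Lams -` {t \<in> space (half_space 0 K). \<forall>i\<in>{0<..K}. b i \<le> t i} \<inter> space M"
    by (auto simp: space_PiM)
  also have "\<dots> \<in> sets M"
  proof (rule measurable_sets)
    show "{t \<in> space (half_space 0 K). \<forall>i\<in>{0<..K}. b i \<le> t i} \<in> sets (half_space 0 K)"
      using pred_lower_bounds[of "{0<..K}" "{0<..K}" b] by (simp add: Measurable.pred_def)
  qed measurable
  finally show ?thesis .
qed

lemma emeasure_lower_bounds_event: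
  assumes "mono_on {0<..K} b" "\<And>i. i \<in> {0<..K} \<Longrightarrow> 0 \<le> b i"
  shows "emeasure M {z \<in> space M. \<forall>i\<in>{0<..K}. b i \<le> Lam (z i)} = ennreal (exp (- b K) * mgev_J K b)"
proof -
  let ?F = "\<lambda>t. if \<forall>i\<in>{0<..K}. b i \<le> t i then 1 else 0 :: ennreal"
  have F: "?F \<in> borel_measurable (half_space 0 K)"
    using pred_lower_bounds[of "{0<..K}" "{0<..K}" b] by measurable
  have "emeasure M {z \<in> space M. \<forall>i\<in>{0<..K}. b i \<le> Lam (z i)}
      = (\<integral>\<^sup>+ z. indicator {z \<in> space M. \<forall>i\<in>{0<..K}. b i \<le> Lam (z i)} z \<partial>M)"
    using lower_bounds_event_measurable by simp
  also have "\<dots> = (\<integral>\<^sup>+ z. ?F (Lams z) \<partial>M)"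
    by (intro nn_integral_cong) (simp add: indicator_def)
  also have "\<dots> = dominating_integral 0 K b"
    unfolding nn_integral_mgev[OF F] dominating_integral_def
    by (intro nn_integral_cong) auto
  also have "\<dots> = ennreal (exp (- b K) * mgev_J K b)"
    using dominating_integral_eq(2)[OF _ assms] K by simp
  finally show ?thesis .
qed

text \<open>
  The total mass is the case of lower bounds \<open>0\<close>, for which \<open>J\<close> is \<open>1\<close>.
\<close>

lemma prob_space_mgev: "prob_space M"
proof
  have "{z \<in> space M. \<forall>i\<in>{0<..K}. 0 \<le> Lam (z i)} = space M"
    by (auto simp: mgev_Lambda_def)
  then show "emeasure M (space M) = 1"
    using emeasure_lower_bounds_event[of "\<lambda>_. 0"] mgev_J_const[OF K] by (simp add: monotone_on_def)
qed

lemma measure_lower_bounds_event: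
  assumes "mono_on {0<..K} b" "\<And>i. i \<in> {0<..K} \<Longrightarrow> 0 \<le> b i"
  shows "measure M {z \<in> space M. \<forall>i\<in>{0<..K}. b i \<le> Lam (z i)} = exp (- b K) * mgev_J K b"
  using emeasure_lower_bounds_event[OF assms] dominating_integral_eq(1)[OF _ assms] K
  by (simp add: measure_def)

lemma AE_mgev: "AE z in M. z \<in> mgev_Omega K \<mu> \<sigma> \<xi>"
proof -
  have "AE z in Pi\<^sub>M {0<..K} (\<lambda>_. lborel). 0 < ennreal (mgev_density K \<mu> \<sigma> \<xi> z) \<longrightarrow> z \<in> mgev_Omega K \<mu> \<sigma> \<xi>"
    by (auto simp: mgev_density_def)
  then show ?thesis
    unfolding mgev_def K_interval by (subst AE_density[OF mgev_density_measurable])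
qed

lemma mgev_Omega_D:
  assumes "z \<in> mgev_Omega K \<mu> \<sigma> \<xi>"
  shows "i \<in> {0<..K} \<Longrightarrow> z i \<in> gev_support \<mu> \<sigma> \<xi>"
    and "0 < i \<Longrightarrow> i \<le> j \<Longrightarrow> j \<le> K \<Longrightarrow> Lam (z i) \<le> Lam (z j)"
proof -
  show "i \<in> {0<..K} \<Longrightarrow> z i \<in> gev_support \<mu> \<sigma> \<xi>"
    using assms mgev_Omega_iff[OF \<sigma> K] by blast
  have "increasing 0 K (\<lambda>i. Lam (z i))"
    using assms mgev_Omega_iff[OF \<sigma> K] by blast
  from increasing_less[OF this, of i j]
  show "0 < i \<Longrightarrow> i \<le> j \<Longrightarrow> j \<le> K \<Longrightarrow> Lam (z i) \<le> Lam (z j)"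
    by (cases "i = j") auto
qed

lemma component_measurable: "m \<in> {0<..K} \<Longrightarrow> (\<lambda>y. y m) \<in> borel_measurable M"
  using measurable_component_singleton[of m "{0<..K}" "\<lambda>_. lborel :: real measure"]
  by (simp cong: measurable_cong_sets add: sets_mgev)

text \<open>
  On \<open>\<Omega>\<close>, the event \<open>Z\<^sub>m \<le> x\<close> says that \<open>\<Lambda>(Z\<^sub>m) \<ge> \<Lambda>(x)\<close>. By monotonicity the
  later coordinates then satisfy the same bound, so this is a case of lower bounds that are increasing,
  namely \<open>0\<close> before \<open>m\<close> and \<open>\<Lambda>(x)\<close> from \<open>m\<close> on.
\<close>

lemma marginal_cdf_mgev:
  assumes m: "m \<in> {0<..K}" and x: "x \<in> gev_support \<mu> \<sigma> \<xi>"
  shows "marginal_cdf M m x = erlang_tail m (Lam x)"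
proof -
  interpret prob_space M by (rule prob_space_mgev)
  let ?b = "\<lambda>i. if i < m then 0 else Lam x"
  have pos: "0 < Lam x" using mgev_Lambda_pos[OF x] .
  have [measurable]: "(\<lambda>y. y m) \<in> borel_measurable M" using component_measurable[OF m] .
  have "marginal_cdf M m x = measure M {y \<in> space M. y m \<le> x}"
    unfolding marginal_cdf_def cdf_def
    by (subst measure_distr) (auto intro!: arg_cong[where f = "measure M"])
  also have "\<dots> = measure M {z \<in> space M. \<forall>i\<in>{0<..K}. ?b i \<le> Lam (z i)}"
  proof (rule finite_measure_eq_AE)
    show "AE z in M. z \<in> {y \<in> space M. y m \<le> x} \<longleftrightarrow>
        z \<in> {z \<in> space M. \<forall>i\<in>{0<..K}. ?b i \<le> Lam (z i)}"
      using AE_mgev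
    proof (eventually_elim)
      case (elim z)
      note D = mgev_Omega_D[OF elim]
      have "z m \<le> x \<longleftrightarrow> Lam x \<le> Lam (z m)"
        using mgev_Lambda_less_iff[OF \<sigma> x D(1)[OF m]] by linarith
      also have "\<dots> \<longleftrightarrow> (\<forall>i\<in>{0<..K}. ?b i \<le> Lam (z i))"
      proof
        assume *: "Lam x \<le> Lam (z m)"
        show "\<forall>i\<in>{0<..K}. ?b i \<le> Lam (z i)"
        proof
          fix i assume i: "i \<in> {0<..K}"
          show "?b i \<le> Lam (z i)"
          proof (cases "i < m")
            case True
            then show ?thesis using mgev_Lambda_pos[OF D(1)[OF i]] by simp
          next
            case False
            then have "Lam (z m) \<le> Lam (z i)" using i m by (intro D(2)) auto
            with * False show ?thesis by simp
          qed
        qed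
      next
        assume *: "\<forall>i\<in>{0<..K}. ?b i \<le> Lam (z i)"
        from bspec[OF * m] show "Lam x \<le> Lam (z m)" by simp
      qed
      finally show ?case by simp
    qed
    show "{y \<in> space M. y m \<le> x} \<in> sets M"
      by (intro borel_measurable_le component_measurable[OF m] borel_measurable_const)
  qed (rule lower_bounds_event_measurable)
  also have "\<dots> = exp (- ?b K) * mgev_J K ?b"
    using pos by (intro measure_lower_bounds_event mono_onI) simp_all
  also have "\<dots> = erlang_tail m (Lam x)"
    using m mgev_J_step[of m K "Lam x"] by (simp add: erlang_tail_def Suc_le_eq not_less)
  finally show ?thesis .
qed

lemma marginal_cdf_measurable:
  assumes "m \<in> {0<..K}"
  shows "marginal_cdf M m \<in> borel_measurable borel"
proof -
  interpret prob_space M by (rule prob_space_mgev)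
  interpret D: real_distribution "distr M borel (\<lambda>y. y m)"
    using component_measurable[OF assms] by (rule real_distribution_distr)
  show ?thesis
    unfolding marginal_cdf_def
    by (intro borel_measurable_mono monoI D.cdf_nondecreasing)
qed

text \<open>
  The copula condition bounds \<open>\<Lambda>(Z\<^sub>i)\<close> below by \<open>- ln (psi i (u i))\<close>. For an increasing vector
  these bounds may be replaced by their running maxima \<open>- ln (psi_min i u)\<close>, which are increasing in
  \<open>i\<close>, so that the integral formula applies. If some \<open>u i\<close> is \<open>0\<close> the bound would be infinite
  and the event is null.
\<close>

lemma copula_mgev:
  assumes u: "u \<in> {1..K} \<rightarrow> {0..1}"
  shows "copula {1..K} M u = (if psi_min K u = 0 then 0
    else psi_min K u * mgev_J K (\<lambda>i. - ln (psi_min i u)))"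
proof -
  interpret prob_space M by (rule prob_space_mgev)
  let ?E = "{y \<in> space M. \<forall>i\<in>{0<..K}. marginal_cdf M i (y i) \<le> u i}"
  have E: "?E \<in> sets M"
  proof -
    have "Measurable.pred M (\<lambda>y. \<forall>i\<in>{0<..K}. marginal_cdf M i (y i) \<le> u i)"
      by (intro pred_intros_finite) (auto simp: Measurable.pred_def
        intro!: borel_measurable_le measurable_compose[OF component_measurable marginal_cdf_measurable])
    then show ?thesis by (simp add: Measurable.pred_def)
  qed
  have cop: "copula {1..K} M u = measure M ?E"
    by (simp only: copula_def K_interval)
  have u': "i \<ge> 1" "u i \<in> {0..1}" if "i \<in> {0<..K}" for i
    using that u K_interval by auto
  show ?thesis
  proof (cases "psi_min K u = 0")
    case True
    then obtain l where l: "l \<in> {0<..K}" "psi l (u l) = 0"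
      using psi_min_attained[OF K, of u] K_interval by auto
    then have ul: "u l = 0"
      using psi_inv_psi(1)[OF u'[OF l(1)]] by (simp add: psi_inv_def)
    have "AE y in M. y \<notin> ?E"
      using AE_mgev
    proof eventually_elim
      case (elim y)
      have y: "y l \<in> gev_support \<mu> \<sigma> \<xi>"
        using mgev_Omega_D(1)[OF elim l(1)] .
      have "0 < erlang_tail l (Lam (y l))"
        using l(1) mgev_Lambda_pos[OF y] by (intro erlang_tail_pos) simp_all
      then have "\<not> marginal_cdf M l (y l) \<le> u l"
        unfolding marginal_cdf_mgev[OF l(1) y] ul by simp
      then show ?case using l(1) by blast
    qed
    then have "measure M ?E = 0"
      using E by (simp add: prob_eq_0)
    then show ?thesis using True cop by simp
  next
    case False
    have pm: "0 < psi_min i u" "psi_min i u \<le> 1" if "i \<in> {0<..K}" for i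
    proof -
      have "0 \<le> psi_min K u"
        using psi_min_range[OF u K] by simp
      then show "0 < psi_min i u"
        using False psi_min_antimono[of i K u] that by (simp add: Suc_le_eq)
      show "psi_min i u \<le> 1"
        using psi_min_le[of i i u] psi_inv_psi(2)[OF u'[OF that]] that by (simp add: Suc_le_eq)
    qed
    let ?b = "\<lambda>i. - ln (psi_min i u)"
    have psi_pos: "0 < psi i (u i)" if "i \<in> {0<..K}" for i
      using pm(1)[OF that] psi_min_le[of i i u] that by (simp add: Suc_le_eq)
    have "measure M ?E = measure M {z \<in> space M. \<forall>i\<in>{0<..K}. ?b i \<le> Lam (z i)}"
    proof (rule finite_measure_eq_AE[OF _ E lower_bounds_event_measurable])
      show "AE z in M. z \<in> ?E \<longleftrightarrow> z \<in> {z \<in> space M. \<forall>i\<in>{0<..K}. ?b i \<le> Lam (z i)}"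
        using AE_mgev
      proof eventually_elim
        case (elim z)
        note D = mgev_Omega_D[OF elim]
        have marg: "marginal_cdf M i (z i) \<le> u i \<longleftrightarrow> - ln (psi i (u i)) \<le> Lam (z i)"
          if i: "i \<in> {0<..K}" for i
          unfolding marginal_cdf_mgev[OF i D(1)[OF i]]
          using mgev_Lambda_pos[OF D(1)[OF i]]
          by (intro erlang_tail_le_iff_psi u' psi_pos i) auto
        have "(\<forall>i\<in>{0<..K}. - ln (psi i (u i)) \<le> Lam (z i)) \<longleftrightarrow> (\<forall>i\<in>{0<..K}. ?b i \<le> Lam (z i))"
        proof safe
          fix i assume *: "\<forall>i\<in>{0<..K}. - ln (psi i (u i)) \<le> Lam (z i)" and i: "i \<in> {0<..K}"
          obtain l where l: "l \<in> {1..i}" "psi_min i u = psi l (u l)"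
            using psi_min_attained[of i u] i by auto
          then have "?b i \<le> Lam (z l)" using * i by (simp add: Suc_le_eq)
          also have "\<dots> \<le> Lam (z i)" using l i by (intro D(2)) auto
          finally show "?b i \<le> Lam (z i)" .
        next
          fix i assume *: "\<forall>i\<in>{0<..K}. ?b i \<le> Lam (z i)" and i: "i \<in> {0<..K}"
          have "psi_min i u \<le> psi i (u i)"
            using i by (intro psi_min_le) simp
          then have "- ln (psi i (u i)) \<le> ?b i"
            using pm(1)[OF i] by simp
          also have "\<dots> \<le> Lam (z i)" using * i by blast
          finally show "- ln (psi i (u i)) \<le> Lam (z i)" .
        qed
        moreover have "z \<in> ?E \<longleftrightarrow> z \<in> space M \<and> (\<forall>i\<in>{0<..K}. - ln (psi i (u i)) \<le> Lam (z i))"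
          using marg by blast
        ultimately show ?case by simp
      qed
    qed
    also have "\<dots> = exp (- ?b K) * mgev_J K ?b"
    proof (rule measure_lower_bounds_event)
      show "mono_on {0<..K} ?b"
      proof (rule mono_onI)
        fix i j assume ij: "i \<in> {0<..K}" "j \<in> {0<..K}" "i \<le> j"
        then have "psi_min j u \<le> psi_min i u" by (intro psi_min_antimono) auto
        then show "?b i \<le> ?b j" using pm(1)[OF ij(2)] by simp
      qed
      show "0 \<le> ?b i" if "i \<in> {0<..K}" for i
        using pm[OF that] by simp
    qed
    also have "exp (- ?b K) = psi_min K u"
      using pm(1)[OF K_interval(2)] by simp
    finally show ?thesis using False cop by simp
  qed
qed

end

lemma mgev_r_eq:
  assumes "u \<in> {1..m} \<rightarrow> {0..1}" "m \<ge> 1"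
  shows "mgev_r (m - 1) u = psi_inv m (psi_min m u)"
  using inv_into_psi[OF assms(2) psi_min_range[OF assms]] assms(2) by (simp add: mgev_r_def)

text \<open>
  The functions \<open>r\<^bsub>m-1\<^esub>\<close> are designed to replace each \<open>\<psi>\<^sub>m(u\<^sub>m)\<close> by its running minimum.
\<close>

lemma psi_mgev_r_argument:
  fixes u :: "nat \<Rightarrow> real"
  defines "v \<equiv> \<lambda>m. if m = 1 then u 1 else mgev_r (m - 1) u"
  assumes u: "u \<in> {1..K} \<rightarrow> {0..1}" and m: "m \<in> {1..K}"
  shows "psi m (v m) = psi_min m u" "v m \<in> {0..1}"
proof -
  have "{1..m} \<subseteq> {1..K}" using m by simp
  then have um: "u \<in> {1..m} \<rightarrow> {0..1}" using u by blast
  have m1: "m \<ge> 1" using m by simp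
  have um_m: "u m \<in> {0..1}" using u m by (rule funcset_mem)
  have "psi m (v m) = psi_min m u \<and> v m \<in> {0..1}"
  proof (cases "m = 1")
    case True
    then show ?thesis using um_m by (simp add: v_def psi_min_def)
  next
    case False
    then have "v m = psi_inv m (psi_min m u)"
      using mgev_r_eq[OF um m1] by (simp add: v_def)
    then show ?thesis
      using psi_psi_inv[OF m1 psi_min_range[OF um m1]] by (simp only: simp_thms)
  qed
  then show "psi m (v m) = psi_min m u" "v m \<in> {0..1}" by auto
qed

lemma mgev_H_expand:
  assumes "K \<ge> 1" "u K \<in> {0..1}" "psi K (u K) \<noteq> 0"
  shows "mgev_H K u = u K - psi K (u K) *
    (\<Sum>j=1..K-1. (- ln (psi j (u j))) ^ j / fact j * mgev_J (K - j) (\<lambda>i. - ln (psi (j + i) (u (j + i)))))"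
proof -
  have pos: "psi K (u K) > 0"
    using psi_inv_psi(2)[OF assms(1,2)] assms(3) by auto
  \<comment> \<open>The first sum of the recursion of \<open>J\<close>, times \<open>psi K (u K)\<close>, is \<open>u K\<close>.\<close>
  have "u K = psi_inv K (psi K (u K))"
    using psi_inv_psi(1)[OF assms(1,2)] by simp
  also have "\<dots> = psi K (u K) * (\<Sum>j<K. (- ln (psi K (u K))) ^ j / fact j)"
    using assms(1) pos by (simp add: psi_inv_erlang_tail erlang_tail_def)
  finally have "u K = psi K (u K) * (\<Sum>j<K. (- ln (psi K (u K))) ^ j / fact j)" .
  moreover have "{1..K-1} = {0<..<K}" by auto
  ultimately show ?thesis
    using assms(3) by (simp add: mgev_H_def mgev_J_unfold[OF assms(1)] right_diff_distrib)
qed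

theorem proposition2p3:
  fixes K :: nat and \<mu> \<sigma> \<xi> :: real
  assumes "K \<ge> 2" and "\<sigma> > 0"
  shows
    "(\<forall>u \<in> {1..K} \<rightarrow> {0..1}.
        (\<lambda>m. if m = 1 then u 1 else mgev_r (m - 1) u) \<in> mgev_H_domain K \<and>
        copula {1..K} (mgev K \<mu> \<sigma> \<xi>) u =
          mgev_H K (\<lambda>m. if m = 1 then u 1 else mgev_r (m - 1) u) \<and>
        (\<forall>m\<in>{2..K}. \<forall>l\<in>{1..m}. psi l (u l) = psi_min m u \<longrightarrow>
           mgev_r (m - 1) u = inv_into {0..1} (psi m) (psi l (u l)) \<and>
           mgev_r (m - 1) u =
             (if psi l (u l) = 0 then 0
              else psi l (u l) * (\<Sum>j=0..m-1. (-1) ^ j * (ln (psi l (u l))) ^ j / fact j)))) \<and>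
     (\<forall>u \<in> mgev_H_domain K.
        mgev_H K u =
          (if psi K (u K) = 0 then 0
           else psi K (u K) *
                mgev_J K (\<lambda>i. if i = 1 then - ln (u 1) else - ln (psi i (u i)))) \<and>
        mgev_H K u =
          (if psi K (u K) = 0 then 0
           else u K - psi K (u K) *
                (\<Sum>j=1..K-1. (- ln (psi j (u j))) ^ j / fact j *
                   mgev_J (K - j) (\<lambda>i. - ln (psi (j + i) (u (j + i)))))))"
proof -
  have K: "K \<ge> 1" "K \<in> {1..K}" "1 \<in> {1..K}" using assms by auto
  show ?thesis
  proof (intro conjI ballI impI)
    fix u assume u: "u \<in> {1..K} \<rightarrow> {0..1::real}"
    let ?v = "\<lambda>m. if m = 1 then u 1 else mgev_r (m - 1) u"
    note v = psi_mgev_r_argument[OF u]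
    show "?v \<in> mgev_H_domain K"
      unfolding mgev_H_domain_def
    proof (intro CollectI conjI ballI)
      show "?v \<in> {1..K} \<rightarrow> {0..1}" using v(2) by blast
      fix j assume "j \<in> {1..<K}"
      then have "j \<in> {1..K}" "Suc j \<in> {1..K}" by auto
      from v(1)[OF this(1)] v(1)[OF this(2)] \<open>j \<in> {1..<K}\<close>
      show "psi j (?v j) \<ge> psi (Suc j) (?v (Suc j))"
        using psi_min_antimono[of j "Suc j" u] by auto
    qed
    have "mgev_J K (\<lambda>i. - ln (psi i (?v i))) = mgev_J K (\<lambda>i. - ln (psi_min i u))"
      using v(1) by (intro mgev_J_cong) presburger
    then show "copula {1..K} (mgev K \<mu> \<sigma> \<xi>) u = mgev_H K ?v"
      unfolding copula_mgev[OF K(1) assms(2) u] mgev_H_def v(1)[OF K(2)] by simp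
    fix m l assume m: "m \<in> {2..K}" and l: "l \<in> {1..m}" "psi l (u l) = psi_min m u"
    have "{1..m} \<subseteq> {1..K}" using m by simp
    then have um: "u \<in> {1..m} \<rightarrow> {0..1}" using u by blast
    have m1: "m \<ge> 1" using m by simp
    show "mgev_r (m - 1) u = inv_into {0..1} (psi m) (psi l (u l))"
      using m by (simp add: mgev_r_def l(2))
    show "mgev_r (m - 1) u = (if psi l (u l) = 0 then 0
        else psi l (u l) * (\<Sum>j=0..m-1. (-1) ^ j * (ln (psi l (u l))) ^ j / fact j))"
      unfolding mgev_r_eq[OF um m1] psi_inv_def l(2) ..
  next
    fix u assume u: "u \<in> mgev_H_domain K"
    then have "u \<in> {1..K} \<rightarrow> {0..1}"
      by (simp add: mgev_H_domain_def)
    then have uK: "u K \<in> {0..1}" and u1: "u 1 \<in> {0..1}"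
      using K(2,3) by (blast intro: funcset_mem)+
    have "psi 1 (u 1) = u 1"
      using u1 by (intro psi_1) simp_all
    then have "(\<lambda>i. if i = 1 then - ln (u 1) else - ln (psi i (u i))) = (\<lambda>i. - ln (psi i (u i)))"
      by auto
    then show "mgev_H K u = (if psi K (u K) = 0 then 0 else psi K (u K) *
        mgev_J K (\<lambda>i. if i = 1 then - ln (u 1) else - ln (psi i (u i))))"
      by (simp only: mgev_H_def)
    show "mgev_H K u = (if psi K (u K) = 0 then 0 else u K - psi K (u K) *
        (\<Sum>j=1..K-1. (- ln (psi j (u j))) ^ j / fact j *
           mgev_J (K - j) (\<lambda>i. - ln (psi (j + i) (u (j + i))))))"
    proof (cases "psi K (u K) = 0")
      case True
      then show ?thesis by (simp only: mgev_H_def refl if_True)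
    next
      case False
      then show ?thesis
        unfolding mgev_H_expand[of K u, OF K(1) uK False] by simp
    qed
  qed
qed

end
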